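(* Let $X$ be a Lévy process on $\mathbf{R}$ with characteristic exponent $\Psi$. Suppose that $$\int_{-\infty}^\infty\frac{\mathrm{d}\xi}{\alpha+2\,\mathrm{Re}\,\Psi(\xi)}<\infty$$ for one, and hence all, $\alpha>0$, and in addition that $$\lim_{|\xi|\to\infty}\frac{\mathrm{Re}\,\Psi(\xi)}{\log|\xi|}=\infty.$$ Then, for each fixed $t,\alpha>0$, the process $\{S_\alpha(t,x)\}_{x\in\mathbf{R}}$ has a modification that is in $C^\infty(\mathbf{R})$.
   Context: The characteristic exponent is normalized by $\mathrm{E}\exp(i\xi X_t)=\exp(-t\Psi(\xi))$ for $\xi\in\mathbf{R}$, $t\ge 0$. The first integrability condition implies that $X$ has jointly continuous transition densities $p_t(x,y)$ with respect to Lebesgue measure $m$ on $\mathbf{R}$ ($p_t(x,\cdot)$ is the density of $x+X_t$). Let $W$ be white noise on $\mathbf{R}_+\times\mathbf{R}$ with control measure $\mathrm{d}t\times\mathrm{d}m$ (Lebesgue measure), i.e. its Wiener integrals satisfy $\mathrm{E}[(\int f\,\mathrm{d}W)^2]=\int_0^\infty\int_{\mathbf{R}} f(s,y)^2\,\mathrm{d}y\,\mathrm{d}s$. The Gaussian random field $S_\alpha$ is defined by $$S_\alpha(t,x):=\int_t^\infty\int_{\mathbf{R}}e^{-\alpha s/2}p_s(x,y)\,W(\mathrm{d}y\,\mathrm{d}s),\qquad t>0,\ x\in\mathbf{R}.$$ *)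

theory Defs
  imports "HOL-Probability.Probability"
begin

definition cadlag :: "(real \<Rightarrow> real) \<Rightarrow> bool" where
  "cadlag f \<longleftrightarrow>
     (\<forall>t\<ge>0. continuous (at_right t) f) \<and> (\<forall>t>0. \<exists>l. (f \<longlongrightarrow> l) (at_left t))"

text \<open>Only the values of a process at times \<open>t \<ge> 0\<close> matter.\<close>

definition levy_process :: "'a measure \<Rightarrow> (real \<Rightarrow> 'a \<Rightarrow> real) \<Rightarrow> bool" where
  "levy_process M X \<longleftrightarrow>
     prob_space M \<and>
     (\<forall>t\<ge>0. X t \<in> borel_measurable M) \<and>
     (AE \<omega> in M. X 0 \<omega> = 0) \<and>
     (\<forall>(n::nat) \<tau>. \<tau> 0 \<ge> 0 \<and> (\<forall>i<n. \<tau> i \<le> \<tau> (Suc i)) \<longrightarrow>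
        prob_space.indep_vars M (\<lambda>_. borel) (\<lambda>i \<omega>. X (\<tau> (Suc i)) \<omega> - X (\<tau> i) \<omega>) {..<n}) \<and>
     (\<forall>s t. 0 \<le> s \<and> s \<le> t \<longrightarrow>
        distr M borel (\<lambda>\<omega>. X t \<omega> - X s \<omega>) = distr M borel (X (t - s))) \<and>
     (AE \<omega> in M. cadlag (\<lambda>t. X t \<omega>))"

definition characteristic_exponent ::
  "'a measure \<Rightarrow> (real \<Rightarrow> 'a \<Rightarrow> real) \<Rightarrow> (real \<Rightarrow> complex) \<Rightarrow> bool" where
  "characteristic_exponent M X \<Psi> \<longleftrightarrow>
     (\<forall>t\<ge>0. \<forall>\<xi>. char (distr M borel (X t)) \<xi> = exp (- of_real t * \<Psi> \<xi>))"

definition continuous_transition_densities ::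
  "'a measure \<Rightarrow> (real \<Rightarrow> 'a \<Rightarrow> real) \<Rightarrow> (real \<Rightarrow> real \<Rightarrow> real \<Rightarrow> real) \<Rightarrow> bool" where
  "continuous_transition_densities M X p \<longleftrightarrow>
     (\<forall>t>0. \<forall>x y. 0 \<le> p t x y) \<and>
     (\<forall>t>0. \<forall>x. distributed M lborel (\<lambda>\<omega>. x + X t \<omega>) (\<lambda>y. ennreal (p t x y))) \<and>
     continuous_on ({0<..} \<times> UNIV \<times> UNIV) (\<lambda>(t, x, y). p t x y)"

text \<open>Continuous densities are unique for \<open>t > 0\<close>, so the choice is immaterial as soon as
  they exist.\<close>

definition transition_density ::
  "'a measure \<Rightarrow> (real \<Rightarrow> 'a \<Rightarrow> real) \<Rightarrow> real \<Rightarrow> real \<Rightarrow> real \<Rightarrow> real" where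
  "transition_density M X = (SOME p. continuous_transition_densities M X p)"

text \<open>Variance zero is allowed.\<close>

definition centered_gaussian :: "'b measure \<Rightarrow> ('b \<Rightarrow> real) \<Rightarrow> bool" where
  "centered_gaussian N Y \<longleftrightarrow>
     Y \<in> borel_measurable N \<and>
     ((AE \<omega> in N. Y \<omega> = 0) \<or>
      (\<exists>\<sigma>>0. distributed N lborel Y (\<lambda>y. ennreal (normal_density 0 \<sigma> y))))"

text \<open>White noise with control measure \<open>\<mu>\<close>: a centered Gaussian process indexed by the
  measurable sets of finite \<open>\<mu>\<close>-measure, with covariance \<open>\<mu> (A \<inter> B)\<close>. Finite additivity
  (almost surely) and independence over disjoint sets are consequences.\<close>

definition white_noise :: "'b measure \<Rightarrow> 'c measure \<Rightarrow> ('c set \<Rightarrow> 'b \<Rightarrow> real) \<Rightarrow> bool" where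
  "white_noise N \<mu> W \<longleftrightarrow>
     prob_space N \<and>
     (\<forall>F c. finite F \<and> F \<subseteq> fmeasurable \<mu> \<longrightarrow>
        centered_gaussian N (\<lambda>\<omega>. \<Sum>A\<in>F. c A * W A \<omega>)) \<and>
     (\<forall>A\<in>fmeasurable \<mu>. \<forall>B\<in>fmeasurable \<mu>.
        (LINT \<omega>|N. W A \<omega> * W B \<omega>) = measure \<mu> (A \<inter> B))"

text \<open>The list \<open>[(c\<^sub>1, A\<^sub>1), \<dots>, (c\<^sub>k, A\<^sub>k)]\<close> represents the step function
  \<open>c\<^sub>1 1\<^bsub>A\<^sub>1\<^esub> + \<dots> + c\<^sub>k 1\<^bsub>A\<^sub>k\<^esub>\<close>, whose Wiener integral is \<open>c\<^sub>1 W(A\<^sub>1) + \<dots> + c\<^sub>k W(A\<^sub>k)\<close>.\<close>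

definition step_function :: "(real \<times> 'c set) list \<Rightarrow> 'c \<Rightarrow> real" where
  "step_function cs z = (\<Sum>(c, A)\<leftarrow>cs. c * indicator A z)"

definition step_integral ::
  "('c set \<Rightarrow> 'b \<Rightarrow> real) \<Rightarrow> (real \<times> 'c set) list \<Rightarrow> 'b \<Rightarrow> real" where
  "step_integral W cs \<omega> = (\<Sum>(c, A)\<leftarrow>cs. c * W A \<omega>)"

text \<open>The Wiener integral is the extension of the integral of step functions to \<open>L\<^sup>2(\<mu>)\<close> by the
  isometry \<open>L\<^sup>2(\<mu>) \<rightarrow> L\<^sup>2(N)\<close>; it is determined up to almost sure equality.\<close>

definition has_wiener_integral ::
  "'b measure \<Rightarrow> 'c measure \<Rightarrow> ('c set \<Rightarrow> 'b \<Rightarrow> real) \<Rightarrow> ('c \<Rightarrow> real) \<Rightarrow> ('b \<Rightarrow> real) \<Rightarrow> bool" where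
  "has_wiener_integral N \<mu> W f Y \<longleftrightarrow>
     f \<in> borel_measurable \<mu> \<and> Y \<in> borel_measurable N \<and>
     (\<exists>cs. (\<forall>n::nat. snd ` set (cs n) \<subseteq> fmeasurable \<mu>) \<and>
        (\<lambda>n. \<integral>\<^sup>+ z. ennreal ((f z - step_function (cs n) z)\<^sup>2) \<partial>\<mu>) \<longlonglongrightarrow> 0 \<and>
        (\<lambda>n. \<integral>\<^sup>+ \<omega>. ennreal ((Y \<omega> - step_integral W (cs n) \<omega>)\<^sup>2) \<partial>N) \<longlonglongrightarrow> 0)"

definition wiener_integral ::
  "'b measure \<Rightarrow> 'c measure \<Rightarrow> ('c set \<Rightarrow> 'b \<Rightarrow> real) \<Rightarrow> ('c \<Rightarrow> real) \<Rightarrow> 'b \<Rightarrow> real" where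
  "wiener_integral N \<mu> W f = (SOME Y. has_wiener_integral N \<mu> W f Y)"

text \<open>Lebesgue measure on \<open>[0, \<infinity>) \<times> \<real>\<close>; points are pairs (time, space).\<close>

definition space_time :: "(real \<times> real) measure" where
  "space_time = restrict_space lborel {0..} \<Otimes>\<^sub>M lborel"

definition S_field ::
  "'a measure \<Rightarrow> (real \<Rightarrow> 'a \<Rightarrow> real) \<Rightarrow> 'b measure \<Rightarrow> ((real \<times> real) set \<Rightarrow> 'b \<Rightarrow> real) \<Rightarrow>
    real \<Rightarrow> real \<Rightarrow> real \<Rightarrow> 'b \<Rightarrow> real" where
  "S_field M X N W \<alpha> t x =
     wiener_integral N space_time W
       (\<lambda>(s, y). indicator {t..} s * (exp (- \<alpha> * s / 2) * transition_density M X s x y))"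

definition modification ::
  "'b measure \<Rightarrow> ('i \<Rightarrow> 'b \<Rightarrow> real) \<Rightarrow> ('i \<Rightarrow> 'b \<Rightarrow> real) \<Rightarrow> bool" where
  "modification N Y Z \<longleftrightarrow>
     (\<forall>x. Y x \<in> borel_measurable N) \<and> (\<forall>x. Z x \<in> borel_measurable N) \<and>
     (\<forall>x. AE \<omega> in N. Y x \<omega> = Z x \<omega>)"

definition C_infinity :: "(real \<Rightarrow> real) set" where
  "C_infinity = {f. \<forall>(n::nat) x. (deriv ^^ n) f field_differentiable at x}"

end

(* Re Psi dominates every multiple of log |xi|, so exp(-2 t Re Psi) has moments of all orders.  By
   Plancherel, the L2 norm of a linear combination of S(t,x_1), ..., S(t,x_n) is at most a multiple
   of the L2 norm of the corresponding trigonometric polynomial with weight exp(-2 t Re Psi).  Hence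
   x -> S(t,x) has mean square derivatives S_0 = S, S_1, S_2, ... of all orders, and the L2 norm of
   2^n (S_j(x + 2^-n) - S_j(x)) - S_(j+1)(x) is O(2^-n) uniformly in x.  Summing the squares over the
   dyadic grids shows that almost surely these errors tend to 0 uniformly over the grid points of
   each bounded interval, so that the dyadic values of the S_j extend to the successive derivatives
   of one smooth function. *)

theory Submission
  imports Defs
begin

section \<open>Fourier inversion\<close>

text \<open>Each \<open>S_field M X N W \<alpha> t x\<close> is picked by \<open>SOME\<close>, for
  every x separately, so relations between different x hold only almost surely and only countably
  many of them may be used at once. This is why paths are examined at dyadic points and reach all
  other points through limits. Transition densities are picked by \<open>SOME\<close> as well;
  inversion of exp(-s \<Psi>), which the growth of Re \<Psi> makes integrable for every s > 0, shows
  that continuous ones exist. The cutoff at t > 0 produces the weight: as Re \<Psi> \<ge> 0, every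
  time s \<ge> t has |exp(-s \<Psi>)|^2 \<le> exp(-2 t Re \<Psi>), and the remaining time integral
  of exp(-\<alpha> s) is exp(-\<alpha> t) / \<alpha>. The rate of the mean square derivatives
  matters: squared errors of order 4^-n meet about 2^n grid points per unit length, and the surplus
  2^-n is summable. Differentiation multiplies the weight by \<xi>^2, so the class of fields whose
  weight has all moments is closed under it, and one estimate serves all orders.\<close>

lemma nondecreasing_imp_deriv_nonneg:
  fixes F :: "real \<Rightarrow> real"
  assumes "mono F" "(F has_real_derivative d) (at x)"
  shows "0 \<le> d"
proof -
  have "((\<lambda>y. (F y - F x) / (y - x)) \<longlongrightarrow> d) (at x)"
    using assms(2) by (simp add: has_field_derivative_iff)
  moreover have "0 \<le> (F y - F x) / (y - x)" for y
    using monoD[OF assms(1), of x y] monoD[OF assms(1), of y x]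
    by (cases "x \<le> y") (auto simp: divide_nonpos_nonpos)
  ultimately show ?thesis
    by (intro tendsto_lowerbound[of _ d "at x" 0]) auto
qed

text \<open>The quotient is the integral of exp(-i \<xi> s) over s from u to v, hence bounded by the
  length of the interval, uniformly in \<xi>. At \<xi> = 0 division by zero makes it 0.\<close>

lemma norm_iexp_diff_quotient_le:
  fixes u v \<xi> :: real
  shows "cmod ((iexp (- (\<xi> * u)) - iexp (- (\<xi> * v))) / (\<i> * \<xi>)) \<le> \<bar>v - u\<bar>"
proof (cases "\<xi> = 0")
  case False
  show ?thesis
  proof (cases "u \<le> v")
    case True
    with Levy_Inversion_aux2[of "-v" "-u" \<xi>] \<open>\<xi> \<noteq> 0\<close> show ?thesis by simp
  next
    case F: False
    have "cmod ((iexp (- (\<xi> * u)) - iexp (- (\<xi> * v))) / (\<i> * \<xi>)) =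
        cmod ((iexp (- (\<xi> * v)) - iexp (- (\<xi> * u))) / (\<i> * \<xi>))"
      by (simp add: norm_divide norm_minus_commute)
    with Levy_Inversion_aux2[of "-u" "-v" \<xi>] \<open>\<xi> \<noteq> 0\<close> F show ?thesis by simp
  qed
qed simp

text \<open>Dominated convergence works along sequences, so the derivative of an integral with
  respect to a parameter is tested on null sequences h.\<close>

lemma has_real_derivative_sequentially:
  fixes f :: "real \<Rightarrow> real"
  assumes "\<And>h::nat \<Rightarrow> real. \<lbrakk>\<And>n. h n \<noteq> 0; h \<longlonglongrightarrow> 0\<rbrakk> \<Longrightarrow>
      (\<lambda>n. (f (x + h n) - f x) / h n) \<longlonglongrightarrow> d"
  shows "(f has_real_derivative d) (at x)"
  unfolding DERIV_def tendsto_at_iff_sequentially using assms by (auto simp: o_def)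

context prob_space
begin

text \<open>The inversion theorem expresses increments of the distribution function at continuity points
  through the function \<open>G\<close> below, which is differentiable because the characteristic function is
  integrable; this rules out atoms.\<close>

lemma distributed_of_integrable_char:
  fixes Y :: "'a \<Rightarrow> real"
  defines "\<phi> \<equiv> char (distr M borel Y)"
  defines "q \<equiv> \<lambda>y. Re (CLBINT \<xi>. iexp (- (\<xi> * y)) * \<phi> \<xi>) / (2 * pi)"
  assumes Y[measurable]: "random_variable borel Y" and int: "integrable lborel \<phi>"
  shows "0 \<le> q y" and "distributed M lborel Y (\<lambda>y. ennreal (q y))"
proof -
  interpret D: real_distribution "distr M borel Y" by simp
  have [measurable]: "\<phi> \<in> borel_measurable borel" unfolding \<phi>_def by measurable
  let ?\<mu> = "distr M borel Y"
  let ?F = "cdf ?\<mu>"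
  \<comment> \<open>The integrand of Levy's inversion formula. Since \<phi> is integrable, the bound
    |v - u| |\<phi>| makes it integrable over the whole line, so the truncated integrals of the
    formula converge to a genuine one.\<close>
  define K where "K u v \<xi> = (iexp (- (\<xi> * u)) - iexp (- (\<xi> * v))) / (\<i> * complex_of_real \<xi>) * \<phi> \<xi>"
    for u v \<xi> :: real
  have K_meas[measurable]: "K u v \<in> borel_measurable borel" for u v unfolding K_def by measurable
  have K_le: "cmod (K u v \<xi>) \<le> \<bar>v - u\<bar> * cmod (\<phi> \<xi>)" for u v \<xi>
    unfolding K_def norm_mult by (intro mult_right_mono norm_iexp_diff_quotient_le) auto
  have K_int: "integrable lborel (K u v)" for u v
    by (rule Bochner_Integration.integrable_bound[of _ "\<lambda>\<xi>. \<bar>v - u\<bar> * cmod (\<phi> \<xi>)"])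
       (use int K_le in auto)
  define G where "G u = Re (CLBINT \<xi>. K 0 u \<xi>) / (2 * pi)" for u
  have G_diff: "G v - G u = Re (CLBINT \<xi>. K u v \<xi>) / (2 * pi)" for u v
  proof -
    have "(CLBINT \<xi>. K 0 v \<xi>) - (CLBINT \<xi>. K 0 u \<xi>) = (CLBINT \<xi>. K 0 v \<xi> - K 0 u \<xi>)"
      by (rule Bochner_Integration.integral_diff[symmetric]) (auto intro: K_int)
    also have "\<dots> = (CLBINT \<xi>. K u v \<xi>)"
      by (intro Bochner_Integration.integral_cong) (auto simp: K_def diff_divide_distrib left_diff_distrib)
    finally show ?thesis unfolding G_def
      by (metis diff_divide_distrib minus_complex.sel(1))
  qed
  have G_deriv: "(G has_real_derivative q u) (at u)" for u
  proof (rule has_real_derivative_sequentially)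
    fix h :: "nat \<Rightarrow> real" assume h: "\<And>n. h n \<noteq> 0" "h \<longlonglongrightarrow> 0"
    have "(\<lambda>n. CLBINT \<xi>. K u (u + h n) \<xi> / h n) \<longlonglongrightarrow> (CLBINT \<xi>. iexp (- (\<xi> * u)) * \<phi> \<xi>)"
    proof (rule integral_dominated_convergence[where w="\<lambda>\<xi>. cmod (\<phi> \<xi>)"])
      \<comment> \<open>The point \<xi> = 0 has to be left out: there \<open>K\<close> is 0 by
        division by zero, while the limit is \<phi> 0 = 1.\<close>
      show "AE \<xi> in lborel. (\<lambda>n. K u (u + h n) \<xi> / h n) \<longlonglongrightarrow> iexp (- (\<xi> * u)) * \<phi> \<xi>"
        using AE_lborel_singleton[of "0::real"]
      proof eventually_elim
        case (elim \<xi>)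
          have "((\<lambda>z. exp (- (\<i> * \<xi> * z))) has_field_derivative - (\<i> * \<xi>) * exp (- (\<i> * \<xi> * u))) (at (complex_of_real u))"
            by (auto intro!: derivative_eq_intros)
          then have "(\<lambda>k. (exp (- (\<i> * \<xi> * (complex_of_real u + k))) - exp (- (\<i> * \<xi> * u))) / k) \<midarrow>0\<rightarrow>
              - (\<i> * \<xi>) * exp (- (\<i> * \<xi> * u))"
            unfolding DERIV_def .
          moreover have "filterlim (\<lambda>n. complex_of_real (h n)) (at 0) sequentially"
            using h by (auto simp: filterlim_at intro!: tendsto_eq_intros)
          ultimately have "(\<lambda>n. (exp (- (\<i> * \<xi> * (complex_of_real u + complex_of_real (h n)))) - exp (- (\<i> * \<xi> * u))) / h n) \<longlonglongrightarrow>
              - (\<i> * \<xi>) * exp (- (\<i> * \<xi> * u))"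
            by (rule filterlim_compose)
          then have "(\<lambda>n. - ((exp (- (\<i> * \<xi> * (complex_of_real u + complex_of_real (h n)))) - exp (- (\<i> * \<xi> * u))) / h n) * (\<phi> \<xi> / (\<i> * \<xi>)))
              \<longlonglongrightarrow> - (- (\<i> * \<xi>) * exp (- (\<i> * \<xi> * u))) * (\<phi> \<xi> / (\<i> * \<xi>))"
            by (intro tendsto_intros)
          moreover have "- ((exp (- (\<i> * \<xi> * (complex_of_real u + complex_of_real (h n)))) - exp (- (\<i> * \<xi> * u))) / h n) * (\<phi> \<xi> / (\<i> * \<xi>)) = K u (u + h n) \<xi> / h n" for n
            by (simp add: K_def algebra_simps diff_divide_distrib)
          ultimately show ?case using elim by (simp add: mult.assoc)
      qed
      show "AE \<xi> in lborel. norm (K u (u + h n) \<xi> / h n) \<le> cmod (\<phi> \<xi>)" for n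
        using K_le[of u "u + h n"] h(1)[of n] by (auto simp: norm_divide field_simps)
    qed (use int in auto)
    then have "(\<lambda>n. Re (CLBINT \<xi>. K u (u + h n) \<xi> / h n) / (2 * pi)) \<longlonglongrightarrow> q u"
      unfolding q_def by (intro tendsto_intros) auto
    then show "(\<lambda>n. (G (u + h n) - G u) / h n) \<longlonglongrightarrow> q u"
      unfolding G_diff by (simp add: mult.commute)
  qed
  have incr: "measure ?\<mu> {a<..b} = G b - G a"
    if "a \<le> b" and a: "measure ?\<mu> {a} = 0" and b: "measure ?\<mu> {b} = 0" for a b
  proof -
    have "(\<lambda>T::nat. (CLBINT \<xi>. indicator {-T<..<T} \<xi> *\<^sub>R K a b \<xi>)) \<longlonglongrightarrow> (CLBINT \<xi>. K a b \<xi>)"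
    proof (rule integral_dominated_convergence[where w="\<lambda>\<xi>. cmod (K a b \<xi>)"])
      show "AE \<xi> in lborel. (\<lambda>T::nat. indicator {- real T<..<real T} \<xi> *\<^sub>R K a b \<xi>) \<longlonglongrightarrow> K a b \<xi>"
      proof (rule AE_I2)
        fix \<xi> :: real
        obtain n :: nat where "\<bar>\<xi>\<bar> < n" using reals_Archimedean2 by blast
        then have "\<forall>\<^sub>F T::nat in sequentially. indicator {- real T<..<real T} \<xi> *\<^sub>R K a b \<xi> = K a b \<xi>"
          by (intro eventually_sequentiallyI[of n]) (auto split: split_indicator)
        then show "(\<lambda>T::nat. indicator {- real T<..<real T} \<xi> *\<^sub>R K a b \<xi>) \<longlonglongrightarrow> K a b \<xi>"
          by (rule tendsto_eventually)
      qed
    qed (use K_int in \<open>auto split: split_indicator\<close>)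
    moreover have "(CLBINT \<xi>=-real T..real T. (iexp (-(\<xi> * a)) - iexp (-(\<xi> * b))) / (\<i> * \<xi>) * \<phi> \<xi>)
        = (CLBINT \<xi>. indicator {-T<..<T} \<xi> *\<^sub>R K a b \<xi>)" for T :: nat
      by (simp add: interval_lebesgue_integral_def set_lebesgue_integral_def K_def)
    ultimately have "(\<lambda>T::nat. 1 / (2 * pi) *
        (CLBINT \<xi>=-real T..real T. (iexp (-(\<xi> * a)) - iexp (-(\<xi> * b))) / (\<i> * \<xi>) * \<phi> \<xi>))
        \<longlonglongrightarrow> 1 / (2 * pi) * (CLBINT \<xi>. K a b \<xi>)"
      by (intro tendsto_intros) simp
    moreover have "(\<lambda>T::nat. 1 / (2 * pi) *
        (CLBINT \<xi>=-real T..real T. (iexp (-(\<xi> * a)) - iexp (-(\<xi> * b))) / (\<i> * \<xi>) * \<phi> \<xi>))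
        \<longlonglongrightarrow> complex_of_real (measure ?\<mu> {a<..b})"
      using D.Levy_Inversion[OF that, folded \<phi>_def] by simp
    ultimately have "1 / (2 * pi) * (CLBINT \<xi>. K a b \<xi>) = complex_of_real (measure ?\<mu> {a<..b})"
      by (rule LIMSEQ_unique)
    then have "complex_of_real (measure ?\<mu> {a<..b}) = 1 / (2 * pi) * (CLBINT \<xi>. K a b \<xi>)" by simp
    then have "measure ?\<mu> {a<..b} = Re (1 / (2 * pi) * (CLBINT \<xi>. K a b \<xi>))"
      by (metis Re_complex_of_real)
    then show ?thesis unfolding G_diff by simp
  qed
  have G_cont: "isCont G x" for x using G_deriv DERIV_isCont by blast
  have no_atom: "measure ?\<mu> {x} = 0" for x
  proof (rule antisym[OF field_le_epsilon])
    fix \<epsilon> :: real assume "0 < \<epsilon>"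
    then obtain d where d: "d > 0" "\<And>y. dist y x < d \<Longrightarrow> dist (G y) (G x) < \<epsilon> / 2"
      using G_cont[of x] unfolding continuous_at_eps_delta by (metis half_gt_zero dist_commute)
    \<comment> \<open>The inversion formula needs endpoints without mass. Only countably many points
      carry mass, so such endpoints exist on both sides of x within distance d, and
      \<open>{x}\<close> is squeezed into an interval of mass \<open>G b - G a\<close>.\<close>
    have c: "countable {x. measure ?\<mu> {x} \<noteq> 0}" by (rule D.countable_support)
    from open_minus_countable[OF c, of "{x-d<..<x}"] \<open>d > 0\<close>
    obtain a where a: "x - d < a" "a < x" "measure ?\<mu> {a} = 0" by auto
    from open_minus_countable[OF c, of "{x<..<x+d}"] \<open>d > 0\<close>
    obtain b where b: "x < b" "b < x + d" "measure ?\<mu> {b} = 0" by auto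
    have "measure ?\<mu> {x} \<le> measure ?\<mu> {a<..b}"
      using a b by (intro D.finite_measure_mono) auto
    also have "\<dots> = G b - G a" using a b by (intro incr) auto
    also have "\<dots> \<le> \<epsilon>"
    proof -
      have "\<bar>G a - G x\<bar> < \<epsilon> / 2" "\<bar>G b - G x\<bar> < \<epsilon> / 2"
        using d(2)[of a] d(2)[of b] a b by (auto simp: dist_real_def)
      then show ?thesis by linarith
    qed
    finally show "measure ?\<mu> {x} \<le> 0 + \<epsilon>" by simp
  qed simp
  have F_eq: "?F y = G y + (?F 0 - G 0)" for y
    using incr[of 0 y] incr[of y 0] no_atom D.cdf_diff_eq[of 0 y] D.cdf_diff_eq[of y 0]
    by (cases y "0::real" rule: linorder_cases) auto
  have F_deriv: "(?F has_real_derivative q y) (at y)" for y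
    by (subst F_eq[abs_def]) (auto intro!: derivative_eq_intros G_deriv)
  have q_nonneg: "0 \<le> q y" for y
    by (rule nondecreasing_imp_deriv_nonneg[OF _ F_deriv]) (auto intro!: monoI D.cdf_nondecreasing)
  then show "0 \<le> q y" .
  have q_meas[measurable]: "q \<in> borel_measurable borel" unfolding q_def by measurable
  have "(\<integral>\<^sup>+x. ennreal (q x * indicator {..a} x) \<partial>lborel) = ennreal (?F a)" for a
  proof -
    \<comment> \<open>The reflection y -> -y turns the half line up to a into \<open>{-a..}\<close>,
      where the fundamental theorem of calculus is available; the limit it needs at infinity is that
      of the distribution function at minus infinity.\<close>
    have "((\<lambda>y. - ?F (- y)) has_real_derivative q (- y)) (at y)" for y
      by (rule derivative_eq_intros DERIV_chain2[OF F_deriv] refl | simp)+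
    then have "(\<integral>\<^sup>+x. ennreal (q (- x)) * indicator {-a..} x \<partial>lborel) = ennreal (- 0 - (- ?F (- (- a))))"
      using tendsto_minus[of "\<lambda>y. ?F (- y)" 0 at_top] D.cdf_lim_at_bot q_nonneg
      by (intro nn_integral_FTC_atLeast) (auto simp: filterlim_at_bot_mirror)
    moreover have "(\<integral>\<^sup>+x. ennreal (q x) * indicator {..a} x \<partial>lborel) =
        (\<integral>\<^sup>+x. ennreal (q (- x)) * indicator {..a} (- x) \<partial>lborel)"
      by (subst nn_integral_real_affine[where c="-1" and t=0]) auto
    moreover have "indicator {..a} (- x) = (indicator {-a..} x :: ennreal)" for x
      by (auto split: split_indicator)
    moreover have "(\<integral>\<^sup>+x. ennreal (q x * indicator {..a} x) \<partial>lborel) = (\<integral>\<^sup>+x. ennreal (q x) * indicator {..a} x \<partial>lborel)"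
      by (intro nn_integral_cong) (auto split: split_indicator)
    ultimately show ?thesis by simp
  qed
  moreover have "emeasure M {x\<in>space M. Y x \<le> a} = ennreal (?F a)" for a
    by (simp add: cdf_def measure_distr emeasure_eq_measure vimage_def Int_def conj_commute)
  ultimately show "distributed M lborel Y (\<lambda>y. ennreal (q y))"
    by (intro distributedI_borel_atMost[where g="?F"]) (auto simp: q_nonneg)
qed

end

section \<open>Mean square estimates\<close>

text \<open>A first moment version of Borel-Cantelli: the sum has a finite integral, so it is finite
  almost everywhere. It turns mean square rates into pathwise convergence.\<close>

lemma AE_summable_of_nn_integral:
  fixes T :: "nat \<Rightarrow> 'a \<Rightarrow> real"
  assumes [measurable]: "\<And>n. T n \<in> borel_measurable M"
    and nonneg: "\<And>n \<omega>. 0 \<le> T n \<omega>"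
    and le: "\<And>n. (\<integral>\<^sup>+\<omega>. ennreal (T n \<omega>) \<partial>M) \<le> ennreal (c n)" and c: "summable c" "\<And>n. 0 \<le> c n"
  shows "AE \<omega> in M. summable (\<lambda>n. T n \<omega>)"
proof -
  have "(\<integral>\<^sup>+\<omega>. (\<Sum>n. ennreal (T n \<omega>)) \<partial>M) = (\<Sum>n. \<integral>\<^sup>+\<omega>. ennreal (T n \<omega>) \<partial>M)"
    by (rule nn_integral_suminf) measurable
  also have "\<dots> \<le> (\<Sum>n. ennreal (c n))"
    by (intro suminf_le le) auto
  also have "\<dots> < \<infinity>"
    using c by (simp add: suminf_ennreal2)
  finally have "AE \<omega> in M. (\<Sum>n. ennreal (T n \<omega>)) \<noteq> \<infinity>"
    by (intro nn_integral_noteq_infinite) auto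
  then show ?thesis
  proof eventually_elim
    case (elim \<omega>)
    then show ?case using nonneg by (intro summable_suminf_not_top) auto
  qed
qed

text \<open>The weight 2^n balances two demands: the weighted squares still have integrals at most C
  / 2^n, and |d| \<le> 2^-n + 2^n d^2 bounds the increments d themselves by a summable
  sequence.\<close>

lemma AE_convergent_of_L2_geometric:
  fixes Y :: "nat \<Rightarrow> 'a \<Rightarrow> real"
  assumes [measurable]: "\<And>n. Y n \<in> borel_measurable M" and "0 \<le> C"
    and le: "\<And>n. (\<integral>\<^sup>+\<omega>. ennreal ((Y (Suc n) \<omega> - Y n \<omega>)\<^sup>2) \<partial>M) \<le> ennreal (C * (1/4) ^ n)"
  shows "AE \<omega> in M. convergent (\<lambda>n. Y n \<omega>)"
proof -
  have "AE \<omega> in M. summable (\<lambda>n. 2 ^ n * (Y (Suc n) \<omega> - Y n \<omega>)\<^sup>2)"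
  proof (rule AE_summable_of_nn_integral[where c="\<lambda>n. C * (1/2) ^ n"])
    fix n
    have "(\<integral>\<^sup>+\<omega>. ennreal (2 ^ n * (Y (Suc n) \<omega> - Y n \<omega>)\<^sup>2) \<partial>M) =
        ennreal (2 ^ n) * (\<integral>\<^sup>+\<omega>. ennreal ((Y (Suc n) \<omega> - Y n \<omega>)\<^sup>2) \<partial>M)"
      by (simp add: ennreal_mult' nn_integral_cmult)
    also have "\<dots> \<le> ennreal (2 ^ n) * ennreal (C * (1/4) ^ n)"
      by (intro mult_left_mono le) auto
    also have "\<dots> = ennreal (C * (2 ^ n * (1/4) ^ n))"
      using \<open>0 \<le> C\<close> by (simp flip: ennreal_mult' add: mult_ac)
    also have "(2::real) ^ n * (1/4) ^ n = (1/2) ^ n" by (simp flip: power_mult_distrib)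
    finally show "(\<integral>\<^sup>+\<omega>. ennreal (2 ^ n * (Y (Suc n) \<omega> - Y n \<omega>)\<^sup>2) \<partial>M) \<le> ennreal (C * (1/2) ^ n)" .
  qed (use \<open>0 \<le> C\<close> in \<open>auto intro!: summable_mult summable_geometric\<close>)
  then show ?thesis
  proof eventually_elim
    case (elim \<omega>)
    let ?d = "\<lambda>n. Y (Suc n) \<omega> - Y n \<omega>"
    have "summable (\<lambda>n. (1/2) ^ n + 2 ^ n * (?d n)\<^sup>2)"
      using elim by (intro summable_add summable_geometric) auto
    moreover have "norm (?d n) \<le> (1/2) ^ n + 2 ^ n * (?d n)\<^sup>2" for n
    proof (cases "\<bar>?d n\<bar> \<le> (1/2) ^ n")
      case True
      then show ?thesis by (simp add: add_increasing2)
    next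
      case False
      have "\<bar>?d n\<bar> = 2 ^ n * ((1/2) ^ n * \<bar>?d n\<bar>)" by (simp add: power_one_over)
      also have "\<dots> \<le> 2 ^ n * (\<bar>?d n\<bar> * \<bar>?d n\<bar>)"
        using False by (intro mult_left_mono mult_right_mono) auto
      also have "\<dots> = 2 ^ n * (?d n)\<^sup>2" by (simp add: power2_eq_square)
      finally show ?thesis by (simp add: add_increasing)
    qed
    ultimately have "summable ?d" by (rule summable_comparison_test'[where N=0])
    then have "convergent (\<lambda>n. Y n \<omega> - Y 0 \<omega>)"
      unfolding summable_iff_convergent sum_lessThan_telescope[of "\<lambda>n. Y n \<omega>"] .
    then show ?case
      using convergent_add_const_right_iff[of "\<lambda>n. Y n \<omega>" "- Y 0 \<omega>"] by simp
  qed
qed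

text \<open>Fatou's lemma, with the bound asked only for large n: a typical application has a fixed
  member m of a sequence compared with member n, which is controlled for n \<ge> m.\<close>

lemma nn_integral_le_of_tendsto:
  fixes Y :: "nat \<Rightarrow> 'a \<Rightarrow> real"
  assumes [measurable]: "\<And>n. Y n \<in> borel_measurable M"
    and lim: "AE \<omega> in M. (\<lambda>n. Y n \<omega>) \<longlonglongrightarrow> Z \<omega>"
    and le: "\<forall>\<^sub>F n in sequentially. (\<integral>\<^sup>+\<omega>. ennreal ((Y n \<omega>)\<^sup>2) \<partial>M) \<le> C"
  shows "(\<integral>\<^sup>+\<omega>. ennreal ((Z \<omega>)\<^sup>2) \<partial>M) \<le> C"
proof -
  have "(\<integral>\<^sup>+\<omega>. ennreal ((Z \<omega>)\<^sup>2) \<partial>M) = (\<integral>\<^sup>+\<omega>. liminf (\<lambda>n. ennreal ((Y n \<omega>)\<^sup>2)) \<partial>M)"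
  proof (rule nn_integral_cong_AE)
    show "AE \<omega> in M. ennreal ((Z \<omega>)\<^sup>2) = liminf (\<lambda>n. ennreal ((Y n \<omega>)\<^sup>2))"
      using lim
    proof eventually_elim
      case (elim \<omega>)
      have "(\<lambda>n. ennreal ((Y n \<omega>)\<^sup>2)) \<longlonglongrightarrow> ennreal ((Z \<omega>)\<^sup>2)"
        by (intro tendsto_intros elim)
      then show ?case using lim_imp_Liminf[OF sequentially_bot] by metis
    qed
  qed
  also have "\<dots> \<le> liminf (\<lambda>n. \<integral>\<^sup>+\<omega>. ennreal ((Y n \<omega>)\<^sup>2) \<partial>M)"
    by (rule nn_integral_liminf) measurable
  also have "\<dots> \<le> C"
  proof -
    have "liminf (\<lambda>n. \<integral>\<^sup>+\<omega>. ennreal ((Y n \<omega>)\<^sup>2) \<partial>M) \<le> limsup (\<lambda>n. \<integral>\<^sup>+\<omega>. ennreal ((Y n \<omega>)\<^sup>2) \<partial>M)"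
      by (intro Liminf_le_Limsup) auto
    also have "\<dots> \<le> C" by (rule Limsup_bounded[OF le])
    finally show ?thesis .
  qed
  finally show ?thesis .
qed

lemma ennreal_square_add_le:
  fixes a b :: real
  shows "ennreal ((a + b)\<^sup>2) \<le> 2 * ennreal (a\<^sup>2) + 2 * ennreal (b\<^sup>2)"
proof -
  have "(a + b)\<^sup>2 \<le> 2 * a\<^sup>2 + 2 * b\<^sup>2"
    using sum_squares_bound[of a b] by (simp add: power2_sum)
  then have "ennreal ((a + b)\<^sup>2) \<le> ennreal (2 * a\<^sup>2 + 2 * b\<^sup>2)" by (rule ennreal_leI)
  then show ?thesis by (simp add: ennreal_mult')
qed

text \<open>Stands in for Minkowski's inequality: the factor 2 avoids square roots, and in
  \<open>ennreal\<close> infinite values do no harm.\<close>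

lemma nn_integral_square_add_le:
  fixes f g :: "'a \<Rightarrow> real"
  assumes [measurable]: "f \<in> borel_measurable M" "g \<in> borel_measurable M"
  shows "(\<integral>\<^sup>+x. ennreal ((f x + g x)\<^sup>2) \<partial>M) \<le>
    2 * (\<integral>\<^sup>+x. ennreal ((f x)\<^sup>2) \<partial>M) + 2 * (\<integral>\<^sup>+x. ennreal ((g x)\<^sup>2) \<partial>M)"
proof -
  have "(\<integral>\<^sup>+x. ennreal ((f x + g x)\<^sup>2) \<partial>M) \<le> (\<integral>\<^sup>+x. 2 * ennreal ((f x)\<^sup>2) + 2 * ennreal ((g x)\<^sup>2) \<partial>M)"
    by (intro nn_integral_mono ennreal_square_add_le)
  also have "\<dots> = 2 * (\<integral>\<^sup>+x. ennreal ((f x)\<^sup>2) \<partial>M) + 2 * (\<integral>\<^sup>+x. ennreal ((g x)\<^sup>2) \<partial>M)"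
    by (simp add: nn_integral_add nn_integral_cmult)
  finally show ?thesis .
qed

section \<open>Wiener integrals\<close>

lemma centered_gaussian_square_integrable:
  assumes "centered_gaussian N Y"
  shows "integrable N (\<lambda>\<omega>. (Y \<omega>)\<^sup>2)"
proof -
  from assms have [measurable]: "Y \<in> borel_measurable N" by (simp add: centered_gaussian_def)
  from assms consider "AE \<omega> in N. Y \<omega> = 0"
    | \<sigma> where "0 < \<sigma>" "distributed N lborel Y (\<lambda>y. ennreal (normal_density 0 \<sigma> y))"
    unfolding centered_gaussian_def by blast
  then show ?thesis
  proof cases
    case 1
    have "integrable N (\<lambda>\<omega>. (Y \<omega>)\<^sup>2) \<longleftrightarrow> integrable N (\<lambda>\<omega>. 0 :: real)"
      by (rule integrable_cong_AE) (use 1 in auto)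
    then show ?thesis by simp
  next
    case 2
    have "integrable lborel (\<lambda>x. normal_density 0 \<sigma> x * x\<^sup>2)"
      using integrable_normal_moment[OF \<open>0 < \<sigma>\<close>, of 0 2] by simp
    then show ?thesis
      using distributed_integrable[OF 2(2), of "\<lambda>x. x\<^sup>2"] by simp
  qed
qed

text \<open>A step function is the step integral for the set function that sends A to its indicator.
  Linearity and the product formula are thereby proved once for both sides of the isometry.\<close>

lemma step_function_eq_step_integral: "step_function cs = step_integral (\<lambda>A z. indicator A z) cs"
  by (simp add: step_function_def step_integral_def fun_eq_iff)

lemma step_integral_simps[simp]:
  "step_integral W [] = (\<lambda>\<omega>. 0)"
  "step_integral W ((c, A) # cs) = (\<lambda>\<omega>. c * W A \<omega> + step_integral W cs \<omega>)"
  by (simp_all add: step_integral_def fun_eq_iff)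

lemma step_integral_affine:
  "step_integral W (map (\<lambda>(c, A). (a * c, A)) cs @ ds) \<omega> = a * step_integral W cs \<omega> + step_integral W ds \<omega>"
  by (induction cs) (auto simp: algebra_simps)

text \<open>Bilinearity, for an arbitrary set-indexed family. It is applied to the noise on the
  sample space and to indicators on the control space; both have product integrals
  \<open>measure \<mu> (A \<inter> B)\<close>, and equality of the two quadratic forms is the
  isometry.\<close>

lemma step_integral_product:
  assumes "\<And>A B. A \<in> \<A> \<Longrightarrow> B \<in> \<A> \<Longrightarrow> has_bochner_integral M (\<lambda>\<omega>. W A \<omega> * W B \<omega>) (m A B)"
    and "snd ` set cs \<subseteq> \<A>" "snd ` set ds \<subseteq> \<A>"
  shows "has_bochner_integral M (\<lambda>\<omega>. step_integral W cs \<omega> * step_integral W ds \<omega>)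
    (\<Sum>(c, A)\<leftarrow>cs. c * (\<Sum>(d, B)\<leftarrow>ds. d * m A B))"
proof -
  have *: "has_bochner_integral M (\<lambda>\<omega>. W A \<omega> * step_integral W ds \<omega>) (\<Sum>(d, B)\<leftarrow>ds. d * m A B)"
    if "A \<in> \<A>" for A
    using assms(3)
  proof (induction ds)
    case (Cons p ds)
    obtain d B where p: "p = (d, B)" by (cases p)
    have "has_bochner_integral M (\<lambda>\<omega>. d * (W A \<omega> * W B \<omega>) + W A \<omega> * step_integral W ds \<omega>)
        (d * m A B + (\<Sum>(d, B)\<leftarrow>ds. d * m A B))"
      using Cons assms(1)[OF that, of B] p
      by (intro has_bochner_integral_add has_bochner_integral_mult_right) auto
    then show ?case by (simp add: p algebra_simps)
  qed (simp add: has_bochner_integral_zero)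
  from assms(2) show ?thesis
  proof (induction cs)
    case (Cons p cs)
    obtain c A where p: "p = (c, A)" by (cases p)
    have "has_bochner_integral M (\<lambda>\<omega>. c * (W A \<omega> * step_integral W ds \<omega>) + step_integral W cs \<omega> * step_integral W ds \<omega>)
        (c * (\<Sum>(d, B)\<leftarrow>ds. d * m A B) + (\<Sum>(c, A)\<leftarrow>cs. c * (\<Sum>(d, B)\<leftarrow>ds. d * m A B)))"
      using Cons *[of A] p by (intro has_bochner_integral_add has_bochner_integral_mult_right) auto
    then show ?case by (simp add: p algebra_simps)
  qed (simp add: has_bochner_integral_zero)
qed

lemma step_functions_dense:
  fixes f :: "'c \<Rightarrow> real"
  assumes [measurable]: "f \<in> borel_measurable \<mu>" and fin: "(\<integral>\<^sup>+z. ennreal ((f z)\<^sup>2) \<partial>\<mu>) < \<infinity>" and "0 < e"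
  shows "\<exists>cs. snd ` set cs \<subseteq> fmeasurable \<mu> \<and> (\<integral>\<^sup>+z. ennreal ((f z - step_function cs z)\<^sup>2) \<partial>\<mu>) < e"
proof -
  obtain F where F: "\<And>i. simple_function \<mu> (F i)" "\<And>x. x \<in> space \<mu> \<Longrightarrow> (\<lambda>i. F i x) \<longlonglongrightarrow> f x"
    "\<And>i x. x \<in> space \<mu> \<Longrightarrow> dist (F i x) 0 \<le> 2 * dist (f x) 0"
    using borel_measurable_implies_sequence_metric[OF assms(1), of 0] by metis
  note [measurable] = borel_measurable_simple_function[OF F(1)]
  have "(\<lambda>i. \<integral>\<^sup>+z. ennreal ((f z - F i z)\<^sup>2) \<partial>\<mu>) \<longlonglongrightarrow> (\<integral>\<^sup>+z. 0 \<partial>\<mu>)"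
  \<comment> \<open>The approximants satisfy |F i| \<le> 2 |f|, so |f - F i| \<le> 3 |f|; squaring
    gives the 9.\<close>
  proof (rule nn_integral_dominated_convergence[where w="\<lambda>z. 9 * ennreal ((f z)\<^sup>2)"])
    show "(\<integral>\<^sup>+z. 9 * ennreal ((f z)\<^sup>2) \<partial>\<mu>) < \<infinity>"
      using fin by (simp add: nn_integral_cmult ennreal_mult_less_top)
    show "AE z in \<mu>. (\<lambda>i. ennreal ((f z - F i z)\<^sup>2)) \<longlonglongrightarrow> 0"
    proof (rule AE_I2)
      fix z assume "z \<in> space \<mu>"
      then have "(\<lambda>i. ennreal ((f z - F i z)\<^sup>2)) \<longlonglongrightarrow> ennreal ((f z - f z)\<^sup>2)"
        by (intro tendsto_intros F)
      then show "(\<lambda>i. ennreal ((f z - F i z)\<^sup>2)) \<longlonglongrightarrow> 0" by simp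
    qed
    show "AE z in \<mu>. ennreal ((f z - F i z)\<^sup>2) \<le> 9 * ennreal ((f z)\<^sup>2)" for i
    proof (rule AE_I2)
      fix z assume "z \<in> space \<mu>"
      then have "\<bar>f z - F i z\<bar> \<le> \<bar>3 * f z\<bar>" using F(3)[of z i] by (simp add: dist_real_def)
      then have "(f z - F i z)\<^sup>2 \<le> 9 * (f z)\<^sup>2"
        by (simp add: abs_le_square_iff power_mult_distrib)
      then have "ennreal ((f z - F i z)\<^sup>2) \<le> ennreal (9 * (f z)\<^sup>2)" by (rule ennreal_leI)
      then show "ennreal ((f z - F i z)\<^sup>2) \<le> 9 * ennreal ((f z)\<^sup>2)" by (simp add: ennreal_mult')
    qed
  qed measurable
  then have "\<forall>\<^sub>F i in sequentially. (\<integral>\<^sup>+z. ennreal ((f z - F i z)\<^sup>2) \<partial>\<mu>) < e"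
    using \<open>0 < e\<close> by (intro order_tendstoD) auto
  then obtain i where i: "(\<integral>\<^sup>+z. ennreal ((f z - F i z)\<^sup>2) \<partial>\<mu>) < e"
    by (auto simp: eventually_sequentially)
  \<comment> \<open>The value 0 is dropped because its level set may have infinite measure. On the
    level set of c \<noteq> 0 one has c^2 \<le> 4 f^2, so Chebyshev's inequality makes its measure
    finite.\<close>
  define V where "V = F i ` space \<mu> - {0}"
  define A where "A c = F i -` {c} \<inter> space \<mu>" for c
  define cs where "cs = map (\<lambda>c. (c, A c)) (sorted_list_of_set V)"
  have "finite V" using F(1)[of i] by (simp add: V_def simple_function_def)
  have fm: "A c \<in> fmeasurable \<mu>" if "c \<in> V" for c
  proof (rule fmeasurableI)
    show [measurable]: "A c \<in> sets \<mu>" unfolding A_def by measurable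
    have "c \<noteq> 0" using that by (simp add: V_def)
    have "ennreal (c\<^sup>2) * emeasure \<mu> (A c) = (\<integral>\<^sup>+z. ennreal (c\<^sup>2) * indicator (A c) z \<partial>\<mu>)"
      by (simp add: nn_integral_cmult_indicator)
    also have "\<dots> \<le> (\<integral>\<^sup>+z. 4 * ennreal ((f z)\<^sup>2) \<partial>\<mu>)"
    proof (rule nn_integral_mono)
      fix z assume z: "z \<in> space \<mu>"
      show "ennreal (c\<^sup>2) * indicator (A c) z \<le> 4 * ennreal ((f z)\<^sup>2)"
      proof (cases "z \<in> A c")
        case True
        then have "\<bar>c\<bar> \<le> \<bar>2 * f z\<bar>" using F(3)[OF z, of i] by (auto simp: A_def dist_real_def)
        then have "c\<^sup>2 \<le> 4 * (f z)\<^sup>2" by (simp add: abs_le_square_iff power_mult_distrib)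
        then have "ennreal (c\<^sup>2) \<le> ennreal (4 * (f z)\<^sup>2)" by (rule ennreal_leI)
        with True show ?thesis by (simp add: ennreal_mult')
      qed simp
    qed
    also have "\<dots> < \<infinity>" using fin by (simp add: nn_integral_cmult ennreal_mult_less_top)
    finally show "emeasure \<mu> (A c) < \<infinity>" using \<open>c \<noteq> 0\<close> by (auto simp: ennreal_mult_less_top)
  qed
  have "step_function cs z = F i z" if "z \<in> space \<mu>" for z
  proof -
    have "step_function cs z = (\<Sum>c\<in>V. c * indicator (A c) z)"
      using \<open>finite V\<close> unfolding step_function_def cs_def
      by (simp add: sum_list_distinct_conv_sum_set comp_def case_prod_beta)
    also have "\<dots> = (\<Sum>c\<in>V. if c = F i z then c else 0)"
      using that by (intro sum.cong) (auto simp: A_def)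
    also have "\<dots> = F i z" using \<open>finite V\<close> that by (auto simp: V_def)
    finally show ?thesis .
  qed
  then have "(\<integral>\<^sup>+z. ennreal ((f z - step_function cs z)\<^sup>2) \<partial>\<mu>) = (\<integral>\<^sup>+z. ennreal ((f z - F i z)\<^sup>2) \<partial>\<mu>)"
    by (intro nn_integral_cong) simp
  moreover have "snd ` set cs \<subseteq> fmeasurable \<mu>" using fm \<open>finite V\<close> by (auto simp: cs_def)
  ultimately show ?thesis using i by metis
qed

lemma has_wiener_integralE:
  assumes "has_wiener_integral N \<mu> W f Y"
  obtains cs where "f \<in> borel_measurable \<mu>" "Y \<in> borel_measurable N"
    "\<And>n. snd ` set (cs n) \<subseteq> fmeasurable \<mu>"
    "(\<lambda>n. \<integral>\<^sup>+z. ennreal ((f z - step_function (cs n) z)\<^sup>2) \<partial>\<mu>) \<longlonglongrightarrow> 0"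
    "(\<lambda>n. \<integral>\<^sup>+\<omega>. ennreal ((Y \<omega> - step_integral W (cs n) \<omega>)\<^sup>2) \<partial>N) \<longlonglongrightarrow> 0"
  using assms unfolding has_wiener_integral_def by (elim conjE exE, intro that) (assumption | erule spec)+

locale white_noise_field =
  fixes N :: "'b measure" and \<mu> :: "'c measure" and W :: "'c set \<Rightarrow> 'b \<Rightarrow> real"
  assumes white_noise: "white_noise N \<mu> W"
begin

lemma gaussian: "A \<in> fmeasurable \<mu> \<Longrightarrow> centered_gaussian N (W A)"
proof -
  assume "A \<in> fmeasurable \<mu>"
  then have "centered_gaussian N (\<lambda>\<omega>. \<Sum>A\<in>{A}. 1 * W A \<omega>)"
    using white_noise unfolding white_noise_def by (elim conjE allE[of _ "{A}"] allE[of _ "\<lambda>_. 1"]) simp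
  then show ?thesis by simp
qed

lemma measurable_noise: "A \<in> fmeasurable \<mu> \<Longrightarrow> W A \<in> borel_measurable N"
  using gaussian by (simp add: centered_gaussian_def)

text \<open>\<open>LINT\<close> is 0 for functions that are not integrable, so the covariance
  formula alone does not give integrability of the product. It comes from the finite Gaussian second
  moments through |ab| \<le> a^2 + b^2.\<close>

lemma has_bochner_integral_noise_product:
  assumes "A \<in> fmeasurable \<mu>" "B \<in> fmeasurable \<mu>"
  shows "has_bochner_integral N (\<lambda>\<omega>. W A \<omega> * W B \<omega>) (measure \<mu> (A \<inter> B))"
proof -
  note [measurable] = assms[THEN measurable_noise]
  have "integrable N (\<lambda>\<omega>. W A \<omega> * W B \<omega>)"
  proof (rule Bochner_Integration.integrable_bound)
    show "integrable N (\<lambda>\<omega>. (W A \<omega>)\<^sup>2 + (W B \<omega>)\<^sup>2)"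
      by (intro Bochner_Integration.integrable_add centered_gaussian_square_integrable gaussian assms)
    have "\<bar>a * b\<bar> \<le> a\<^sup>2 + b\<^sup>2" for a b :: real
      using sum_squares_bound[of "\<bar>a\<bar>" "\<bar>b\<bar>"] abs_ge_zero[of "a * b"]
      unfolding abs_mult power2_abs by linarith
    then show "AE \<omega> in N. norm (W A \<omega> * W B \<omega>) \<le> norm ((W A \<omega>)\<^sup>2 + (W B \<omega>)\<^sup>2)" by simp
  qed measurable
  moreover have "(LINT \<omega>|N. W A \<omega> * W B \<omega>) = measure \<mu> (A \<inter> B)"
    using white_noise assms by (simp add: white_noise_def)
  ultimately show ?thesis by (simp add: has_bochner_integral_iff)
qed

lemma has_bochner_integral_indicator_product:
  assumes "A \<in> fmeasurable \<mu>" "B \<in> fmeasurable \<mu>"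
  shows "has_bochner_integral \<mu> (\<lambda>z. indicator A z * indicator B z :: real) (measure \<mu> (A \<inter> B))"
proof -
  have "A \<inter> B \<in> fmeasurable \<mu>" using assms by (intro fmeasurable.Int)
  then have "has_bochner_integral \<mu> (indicator (A \<inter> B)) (measure \<mu> (A \<inter> B))"
    by (intro has_bochner_integral_real_indicator) (auto dest: fmeasurableD fmeasurableD2 simp: less_top)
  moreover have "(\<lambda>z. indicator A z * indicator B z :: real) = indicator (A \<inter> B)"
    by (simp add: fun_eq_iff indicator_inter_arith)
  ultimately show ?thesis by simp
qed

lemma measurable_step_integral:
  "snd ` set cs \<subseteq> fmeasurable \<mu> \<Longrightarrow> step_integral W cs \<in> borel_measurable N"
proof (induction cs)
  case (Cons p cs)
  obtain c A where p: "p = (c, A)" by (cases p)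
  with Cons have [measurable]: "W A \<in> borel_measurable N" "step_integral W cs \<in> borel_measurable N"
    by (auto intro: measurable_noise)
  show ?case unfolding p by simp
qed simp

lemma measurable_step_function:
  "snd ` set cs \<subseteq> fmeasurable \<mu> \<Longrightarrow> step_function cs \<in> borel_measurable \<mu>"
proof (induction cs)
  case (Cons p cs)
  obtain c A where p: "p = (c, A)" by (cases p)
  with Cons have [measurable]: "A \<in> sets \<mu>" "step_function cs \<in> borel_measurable \<mu>"
    by (auto dest: fmeasurableD)
  then show ?case unfolding p step_function_eq_step_integral by simp
qed (simp add: step_function_eq_step_integral)

lemma step_integral_isometry:
  assumes "snd ` set cs \<subseteq> fmeasurable \<mu>"
  shows "(\<integral>\<^sup>+\<omega>. ennreal ((step_integral W cs \<omega>)\<^sup>2) \<partial>N) = (\<integral>\<^sup>+z. ennreal ((step_function cs z)\<^sup>2) \<partial>\<mu>)"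
proof -
  let ?v = "\<Sum>(c, A)\<leftarrow>cs. c * (\<Sum>(d, B)\<leftarrow>cs. d * measure \<mu> (A \<inter> B))"
  have "has_bochner_integral N (\<lambda>\<omega>. (step_integral W cs \<omega>)\<^sup>2) ?v"
    unfolding power2_eq_square
    by (intro step_integral_product[where \<A>="fmeasurable \<mu>"] has_bochner_integral_noise_product assms)
  then have 1: "(\<integral>\<^sup>+\<omega>. ennreal ((step_integral W cs \<omega>)\<^sup>2) \<partial>N) = ennreal ?v"
    by (auto simp: has_bochner_integral_iff nn_integral_eq_integral)
  have "has_bochner_integral \<mu> (\<lambda>z. (step_function cs z)\<^sup>2) ?v"
    unfolding power2_eq_square step_function_eq_step_integral
    by (intro step_integral_product[where \<A>="fmeasurable \<mu>"] has_bochner_integral_indicator_product assms)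
  then have 2: "(\<integral>\<^sup>+z. ennreal ((step_function cs z)\<^sup>2) \<partial>\<mu>) = ennreal ?v"
    by (auto simp: has_bochner_integral_iff nn_integral_eq_integral)
  from 1 2 show ?thesis by simp
qed

lemma step_integral_diff_isometry:
  assumes "snd ` set cs \<subseteq> fmeasurable \<mu>" "snd ` set ds \<subseteq> fmeasurable \<mu>"
  shows "(\<integral>\<^sup>+\<omega>. ennreal ((step_integral W cs \<omega> - step_integral W ds \<omega>)\<^sup>2) \<partial>N) =
    (\<integral>\<^sup>+z. ennreal ((step_function cs z - step_function ds z)\<^sup>2) \<partial>\<mu>)"
proof -
  have "snd ` set (map (\<lambda>(c, A). (-1 * c, A)) ds @ cs) \<subseteq> fmeasurable \<mu>" using assms by auto
  from step_integral_isometry[OF this] show ?thesis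
    unfolding step_function_eq_step_integral step_integral_affine by simp
qed

text \<open>Squared errors below 4^-n make consecutive step integrals differ by O(4^-n) in mean
  square. They therefore converge almost surely, Y can be a pointwise \<open>lim\<close>, and
  Fatou's lemma carries the rate over to Y.\<close>

lemma has_wiener_integral_exists:
  assumes [measurable]: "f \<in> borel_measurable \<mu>" and fin: "(\<integral>\<^sup>+z. ennreal ((f z)\<^sup>2) \<partial>\<mu>) < \<infinity>"
  shows "\<exists>Y. has_wiener_integral N \<mu> W f Y"
proof -
  have "\<exists>cs. snd ` set cs \<subseteq> fmeasurable \<mu> \<and>
      (\<integral>\<^sup>+z. ennreal ((f z - step_function cs z)\<^sup>2) \<partial>\<mu>) < ennreal ((1/4) ^ n)" for n
    by (rule step_functions_dense[OF assms]) simp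
  then obtain cs where cs: "\<And>n. snd ` set (cs n) \<subseteq> fmeasurable \<mu>"
    and approx: "\<And>n. (\<integral>\<^sup>+z. ennreal ((f z - step_function (cs n) z)\<^sup>2) \<partial>\<mu>) < ennreal ((1/4) ^ n)"
    by metis
  note [measurable] = measurable_step_integral[OF cs] measurable_step_function[OF cs]
  define I where "I n = step_integral W (cs n)" for n
  have [measurable]: "I n \<in> borel_measurable N" for n unfolding I_def by measurable
  have diff: "(\<integral>\<^sup>+\<omega>. ennreal ((I n \<omega> - I m \<omega>)\<^sup>2) \<partial>N) \<le> ennreal (4 * (1/4) ^ m)" if "m \<le> n" for m n
  proof -
    have "(\<integral>\<^sup>+\<omega>. ennreal ((I n \<omega> - I m \<omega>)\<^sup>2) \<partial>N) =
        (\<integral>\<^sup>+z. ennreal ((step_function (cs n) z - step_function (cs m) z)\<^sup>2) \<partial>\<mu>)"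
      unfolding I_def by (rule step_integral_diff_isometry[OF cs cs])
    also have "\<dots> = (\<integral>\<^sup>+z. ennreal (((f z - step_function (cs m) z) + - (f z - step_function (cs n) z))\<^sup>2) \<partial>\<mu>)"
      by (simp add: algebra_simps)
    also have "\<dots> \<le> 2 * (\<integral>\<^sup>+z. ennreal ((f z - step_function (cs m) z)\<^sup>2) \<partial>\<mu>)
        + 2 * (\<integral>\<^sup>+z. ennreal ((- (f z - step_function (cs n) z))\<^sup>2) \<partial>\<mu>)"
      by (rule nn_integral_square_add_le) measurable
    also have "\<dots> \<le> 2 * ennreal ((1/4) ^ m) + 2 * ennreal ((1/4) ^ n)"
      using approx[of m] approx[of n] by (intro add_mono mult_left_mono) (auto simp: power2_commute less_imp_le)
    also have "\<dots> = ennreal (2 * (1/4) ^ m + 2 * (1/4) ^ n)" by (simp add: ennreal_mult')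
    also have "\<dots> \<le> ennreal (4 * (1/4) ^ m)"
      using power_decreasing[OF that, of "1/4::real"] by (intro ennreal_leI) simp
    finally show ?thesis .
  qed
  define Y where "Y \<omega> = lim (\<lambda>n. I n \<omega>)" for \<omega>
  have [measurable]: "Y \<in> borel_measurable N" unfolding Y_def[abs_def] by measurable
  have "AE \<omega> in N. convergent (\<lambda>n. I n \<omega>)"
    by (rule AE_convergent_of_L2_geometric[where C=4]) (auto intro: diff)
  then have lim: "AE \<omega> in N. (\<lambda>n. I n \<omega>) \<longlonglongrightarrow> Y \<omega>"
    by eventually_elim (simp add: Y_def convergent_LIMSEQ_iff)
  have Y_le: "(\<integral>\<^sup>+\<omega>. ennreal ((Y \<omega> - I m \<omega>)\<^sup>2) \<partial>N) \<le> ennreal (4 * (1/4) ^ m)" for m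
  proof (rule nn_integral_le_of_tendsto)
    show "AE \<omega> in N. (\<lambda>n. I n \<omega> - I m \<omega>) \<longlonglongrightarrow> Y \<omega> - I m \<omega>"
      using lim by eventually_elim (intro tendsto_intros)
  qed (auto intro!: eventually_sequentiallyI[of m] diff)
  have "(\<lambda>m. \<integral>\<^sup>+\<omega>. ennreal ((Y \<omega> - I m \<omega>)\<^sup>2) \<partial>N) \<longlonglongrightarrow> 0"
  proof (rule tendsto_sandwich[OF _ _ tendsto_const])
    have "(\<lambda>m. ennreal (4 * (1/4) ^ m)) \<longlonglongrightarrow> ennreal (4 * 0)"
      by (intro tendsto_intros LIMSEQ_power_zero) auto
    then show "(\<lambda>m. ennreal (4 * (1/4) ^ m)) \<longlonglongrightarrow> 0" by simp
    show "\<forall>\<^sub>F m in sequentially. (\<integral>\<^sup>+\<omega>. ennreal ((Y \<omega> - I m \<omega>)\<^sup>2) \<partial>N) \<le> ennreal (4 * (1/4) ^ m)"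
      by (intro always_eventually allI Y_le)
  qed simp
  moreover have "(\<lambda>n. \<integral>\<^sup>+z. ennreal ((f z - step_function (cs n) z)\<^sup>2) \<partial>\<mu>) \<longlonglongrightarrow> 0"
  proof (rule tendsto_sandwich[OF _ _ tendsto_const])
    have "(\<lambda>m. ennreal ((1/4) ^ m)) \<longlonglongrightarrow> ennreal 0"
      by (intro tendsto_intros LIMSEQ_power_zero) auto
    then show "(\<lambda>m. ennreal ((1/4) ^ m)) \<longlonglongrightarrow> 0" by simp
  qed (auto simp: approx less_imp_le)
  ultimately show ?thesis
    unfolding has_wiener_integral_def using cs by (intro exI[of _ Y] conjI exI[of _ cs]) (auto simp: I_def)
qed

lemma has_wiener_integral_wiener_integral:
  assumes "f \<in> borel_measurable \<mu>" "(\<integral>\<^sup>+z. ennreal ((f z)\<^sup>2) \<partial>\<mu>) < \<infinity>"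
  shows "has_wiener_integral N \<mu> W f (wiener_integral N \<mu> W f)"
  unfolding wiener_integral_def using has_wiener_integral_exists[OF assms] by (rule someI_ex)

lemma has_wiener_integral_zero: "has_wiener_integral N \<mu> W (\<lambda>z. 0) (\<lambda>\<omega>. 0)"
  unfolding has_wiener_integral_def
  by (intro conjI exI[of _ "\<lambda>n. []"]) (auto simp: step_function_eq_step_integral)

text \<open>One rule for multiples and sums, in the shape that induction over a list of coefficients
  and points needs.\<close>

lemma has_wiener_integral_affine:
  assumes "has_wiener_integral N \<mu> W f Y" "has_wiener_integral N \<mu> W g Z"
  shows "has_wiener_integral N \<mu> W (\<lambda>z. a * f z + g z) (\<lambda>\<omega>. a * Y \<omega> + Z \<omega>)"
proof -
  obtain cs where [measurable]: "f \<in> borel_measurable \<mu>" "Y \<in> borel_measurable N"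
    and cs: "\<And>n. snd ` set (cs n) \<subseteq> fmeasurable \<mu>"
      "(\<lambda>n. \<integral>\<^sup>+z. ennreal ((f z - step_function (cs n) z)\<^sup>2) \<partial>\<mu>) \<longlonglongrightarrow> 0"
      "(\<lambda>n. \<integral>\<^sup>+\<omega>. ennreal ((Y \<omega> - step_integral W (cs n) \<omega>)\<^sup>2) \<partial>N) \<longlonglongrightarrow> 0"
    by (rule has_wiener_integralE[OF assms(1)], rule that, simp_all)
  obtain ds where [measurable]: "g \<in> borel_measurable \<mu>" "Z \<in> borel_measurable N"
    and ds: "\<And>n. snd ` set (ds n) \<subseteq> fmeasurable \<mu>"
      "(\<lambda>n. \<integral>\<^sup>+z. ennreal ((g z - step_function (ds n) z)\<^sup>2) \<partial>\<mu>) \<longlonglongrightarrow> 0"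
      "(\<lambda>n. \<integral>\<^sup>+\<omega>. ennreal ((Z \<omega> - step_integral W (ds n) \<omega>)\<^sup>2) \<partial>N) \<longlonglongrightarrow> 0"
    by (rule has_wiener_integralE[OF assms(2)], rule that, simp_all)
  note [measurable] = measurable_step_integral[OF cs(1)] measurable_step_integral[OF ds(1)]
    measurable_step_function[OF cs(1)] measurable_step_function[OF ds(1)]
  let ?l = "\<lambda>n. map (\<lambda>(c, A). (a * c, A)) (cs n) @ ds n"
  \<comment> \<open>Stated for an arbitrary measure because it serves twice: for the integrands
    under \<open>\<mu>\<close> and for their integrals under \<open>N\<close>.\<close>
  have L2: "(\<lambda>n. \<integral>\<^sup>+x. ennreal ((a * u x + v x - (a * p n x + q n x))\<^sup>2) \<partial>M) \<longlonglongrightarrow> 0"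
    if [measurable]: "u \<in> borel_measurable M" "v \<in> borel_measurable M" "\<And>n. p n \<in> borel_measurable M" "\<And>n. q n \<in> borel_measurable M"
    and lim: "(\<lambda>n. \<integral>\<^sup>+x. ennreal ((u x - p n x)\<^sup>2) \<partial>M) \<longlonglongrightarrow> 0" "(\<lambda>n. \<integral>\<^sup>+x. ennreal ((v x - q n x)\<^sup>2) \<partial>M) \<longlonglongrightarrow> 0"
    for u v :: "'d \<Rightarrow> real" and p q :: "nat \<Rightarrow> 'd \<Rightarrow> real" and M
  proof (rule tendsto_sandwich[OF _ _ tendsto_const])
    show "\<forall>\<^sub>F n in sequentially. (\<integral>\<^sup>+x. ennreal ((a * u x + v x - (a * p n x + q n x))\<^sup>2) \<partial>M) \<le>
        2 * (ennreal (a\<^sup>2) * (\<integral>\<^sup>+x. ennreal ((u x - p n x)\<^sup>2) \<partial>M)) + 2 * (\<integral>\<^sup>+x. ennreal ((v x - q n x)\<^sup>2) \<partial>M)"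
    proof (rule always_eventually, rule allI)
      fix n
      have "(\<integral>\<^sup>+x. ennreal ((a * u x + v x - (a * p n x + q n x))\<^sup>2) \<partial>M) =
          (\<integral>\<^sup>+x. ennreal ((a * (u x - p n x) + (v x - q n x))\<^sup>2) \<partial>M)"
        by (simp add: algebra_simps)
      also have "\<dots> \<le> 2 * (\<integral>\<^sup>+x. ennreal ((a * (u x - p n x))\<^sup>2) \<partial>M) + 2 * (\<integral>\<^sup>+x. ennreal ((v x - q n x)\<^sup>2) \<partial>M)"
        by (rule nn_integral_square_add_le) measurable
      also have "(\<integral>\<^sup>+x. ennreal ((a * (u x - p n x))\<^sup>2) \<partial>M) = ennreal (a\<^sup>2) * (\<integral>\<^sup>+x. ennreal ((u x - p n x)\<^sup>2) \<partial>M)"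
        by (simp add: power_mult_distrib ennreal_mult' nn_integral_cmult)
      finally show "(\<integral>\<^sup>+x. ennreal ((a * u x + v x - (a * p n x + q n x))\<^sup>2) \<partial>M) \<le>
        2 * (ennreal (a\<^sup>2) * (\<integral>\<^sup>+x. ennreal ((u x - p n x)\<^sup>2) \<partial>M)) + 2 * (\<integral>\<^sup>+x. ennreal ((v x - q n x)\<^sup>2) \<partial>M)" .
    qed
    have "(\<lambda>n. 2 * (ennreal (a\<^sup>2) * (\<integral>\<^sup>+x. ennreal ((u x - p n x)\<^sup>2) \<partial>M)) + 2 * (\<integral>\<^sup>+x. ennreal ((v x - q n x)\<^sup>2) \<partial>M))
        \<longlonglongrightarrow> 2 * (ennreal (a\<^sup>2) * 0) + 2 * 0"
      by (intro tendsto_add ennreal_tendsto_cmult lim) auto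
    then show "(\<lambda>n. 2 * (ennreal (a\<^sup>2) * (\<integral>\<^sup>+x. ennreal ((u x - p n x)\<^sup>2) \<partial>M)) + 2 * (\<integral>\<^sup>+x. ennreal ((v x - q n x)\<^sup>2) \<partial>M))
        \<longlonglongrightarrow> 0" by simp
  qed auto
  have "(\<lambda>n. \<integral>\<^sup>+z. ennreal ((a * f z + g z - step_function (?l n) z)\<^sup>2) \<partial>\<mu>) \<longlonglongrightarrow> 0"
    unfolding step_function_eq_step_integral step_integral_affine
    unfolding step_function_eq_step_integral[symmetric] by (rule L2) (use cs ds in measurable)
  moreover have "(\<lambda>n. \<integral>\<^sup>+\<omega>. ennreal ((a * Y \<omega> + Z \<omega> - step_integral W (?l n) \<omega>)\<^sup>2) \<partial>N) \<longlonglongrightarrow> 0"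
    unfolding step_integral_affine by (rule L2) (use cs ds in measurable)
  moreover have "snd ` set (?l n) \<subseteq> fmeasurable \<mu>" for n using cs(1)[of n] ds(1)[of n] by auto
  ultimately show ?thesis unfolding has_wiener_integral_def by (intro conjI exI[of _ ?l]) auto
qed

text \<open>The isometry gives the constant 1; with 4 the passage to the limit is trivial.\<close>

lemma has_wiener_integral_L2_bound:
  assumes "has_wiener_integral N \<mu> W f Y"
  shows "(\<integral>\<^sup>+\<omega>. ennreal ((Y \<omega>)\<^sup>2) \<partial>N) \<le> 4 * (\<integral>\<^sup>+z. ennreal ((f z)\<^sup>2) \<partial>\<mu>)"
proof -
  obtain cs where [measurable]: "f \<in> borel_measurable \<mu>" "Y \<in> borel_measurable N"
    and cs: "\<And>n. snd ` set (cs n) \<subseteq> fmeasurable \<mu>"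
      "(\<lambda>n. \<integral>\<^sup>+z. ennreal ((f z - step_function (cs n) z)\<^sup>2) \<partial>\<mu>) \<longlonglongrightarrow> 0"
      "(\<lambda>n. \<integral>\<^sup>+\<omega>. ennreal ((Y \<omega> - step_integral W (cs n) \<omega>)\<^sup>2) \<partial>N) \<longlonglongrightarrow> 0"
    by (rule has_wiener_integralE[OF assms], rule that, simp_all)
  note [measurable] = measurable_step_integral[OF cs(1)] measurable_step_function[OF cs(1)]
  let ?F = "\<integral>\<^sup>+z. ennreal ((f z)\<^sup>2) \<partial>\<mu>"
  let ?\<epsilon> = "\<lambda>n. \<integral>\<^sup>+z. ennreal ((f z - step_function (cs n) z)\<^sup>2) \<partial>\<mu>"
  let ?\<delta> = "\<lambda>n. \<integral>\<^sup>+\<omega>. ennreal ((Y \<omega> - step_integral W (cs n) \<omega>)\<^sup>2) \<partial>N"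
  \<comment> \<open>Two splittings, of Y around its step integral and of the step function around f,
    cost a factor 2 each; this is the 4. The error terms vanish as n grows.\<close>
  have "(\<integral>\<^sup>+\<omega>. ennreal ((Y \<omega>)\<^sup>2) \<partial>N) \<le> 2 * ?\<delta> n + 2 * (2 * ?\<epsilon> n + 2 * ?F)" for n
  proof -
    have "(\<integral>\<^sup>+\<omega>. ennreal ((Y \<omega>)\<^sup>2) \<partial>N) = (\<integral>\<^sup>+\<omega>. ennreal (((Y \<omega> - step_integral W (cs n) \<omega>) + step_integral W (cs n) \<omega>)\<^sup>2) \<partial>N)"
      by simp
    also have "\<dots> \<le> 2 * ?\<delta> n + 2 * (\<integral>\<^sup>+\<omega>. ennreal ((step_integral W (cs n) \<omega>)\<^sup>2) \<partial>N)"
      by (rule nn_integral_square_add_le) measurable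
    also have "(\<integral>\<^sup>+\<omega>. ennreal ((step_integral W (cs n) \<omega>)\<^sup>2) \<partial>N) = (\<integral>\<^sup>+z. ennreal ((step_function (cs n) z)\<^sup>2) \<partial>\<mu>)"
      by (rule step_integral_isometry[OF cs(1)])
    also have "\<dots> = (\<integral>\<^sup>+z. ennreal ((- (f z - step_function (cs n) z) + f z)\<^sup>2) \<partial>\<mu>)" by simp
    also have "\<dots> \<le> 2 * (\<integral>\<^sup>+z. ennreal ((- (f z - step_function (cs n) z))\<^sup>2) \<partial>\<mu>) + 2 * ?F"
      by (rule nn_integral_square_add_le) measurable
    also have "(\<integral>\<^sup>+z. ennreal ((- (f z - step_function (cs n) z))\<^sup>2) \<partial>\<mu>) = ?\<epsilon> n" by (simp only: power2_minus)
    finally show ?thesis by (simp add: add_left_mono mult_left_mono)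
  qed
  moreover have "(\<lambda>n. 2 * ?\<delta> n + 2 * (2 * ?\<epsilon> n + 2 * ?F)) \<longlonglongrightarrow> 2 * 0 + 2 * (2 * 0 + 2 * ?F)"
    by (intro tendsto_add ennreal_tendsto_cmult cs tendsto_const) auto
  ultimately have "(\<integral>\<^sup>+\<omega>. ennreal ((Y \<omega>)\<^sup>2) \<partial>N) \<le> 2 * 0 + 2 * (2 * 0 + 2 * ?F)"
    by (intro LIMSEQ_le_const) auto
  then show ?thesis by (simp flip: mult.assoc)
qed

end

section \<open>Smooth functions from dyadic values\<close>

definition dyadics :: "real set" where
  "dyadics = {real_of_int k / 2 ^ n | k n. True}"

definition dyadic_floor :: "nat \<Rightarrow> real \<Rightarrow> real" where
  "dyadic_floor n x = real_of_int \<lfloor>2 ^ n * x\<rfloor> / 2 ^ n"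

lemma dyadic_floor_in_dyadics[simp]: "dyadic_floor n x \<in> dyadics"
  unfolding dyadic_floor_def dyadics_def by blast

lemma dyadic_floor_le: "dyadic_floor n x \<le> x"
  unfolding dyadic_floor_def by (simp add: divide_le_eq mult.commute)

lemma dyadic_floor_ge: "x - 1 / 2 ^ n \<le> dyadic_floor n x"
proof -
  have "(2 ^ n * x - 1) / 2 ^ n \<le> dyadic_floor n x"
    unfolding dyadic_floor_def by (intro divide_right_mono) (linarith, simp)
  then show ?thesis by (simp add: diff_divide_distrib)
qed

lemma dyadic_floor_mono: "x \<le> y \<Longrightarrow> dyadic_floor n x \<le> dyadic_floor n y"
  unfolding dyadic_floor_def by (intro divide_right_mono) (auto intro!: floor_mono)

lemma inverse_power_2_tendsto_zero: "(\<lambda>n. 1 / 2 ^ n :: real) \<longlonglongrightarrow> 0"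
  using LIMSEQ_power_zero[of "1/2::real"] by (simp add: power_one_over)

lemma dyadic_floor_tendsto: "(\<lambda>n. dyadic_floor n x) \<longlonglongrightarrow> x"
proof (rule tendsto_sandwich)
  show "(\<lambda>n. x - 1 / 2 ^ n) \<longlonglongrightarrow> x"
    using tendsto_diff[OF tendsto_const inverse_power_2_tendsto_zero, of x] by simp
qed (auto simp: dyadic_floor_le dyadic_floor_ge)

lemma inverse_power_2_square: "(1 / 2 ^ n :: real)\<^sup>2 = (1/4) ^ n"
proof -
  have "(1 / 2 ^ n :: real)\<^sup>2 = ((1/2)\<^sup>2) ^ n"
    unfolding power_one_over[symmetric] power_mult[symmetric] by (simp only: mult.commute)
  then show ?thesis by (simp add: power2_eq_square)
qed

lemma dyadic_refine:
  assumes "m \<le> n"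
  shows "real_of_int k / 2 ^ m = real_of_int (k * 2 ^ (n - m)) / 2 ^ n"
proof -
  have "(2::real) ^ n = 2 ^ m * 2 ^ (n - m)" using assms by (simp flip: power_add)
  then show ?thesis by simp
qed

lemma dyadic_floor_dyadic:
  assumes "m \<le> n"
  shows "dyadic_floor n (real_of_int k / 2 ^ m) = real_of_int k / 2 ^ m"
  unfolding dyadic_refine[OF assms] dyadic_floor_def by simp

text \<open>\<open>F j\<close> plays the role of the \<open>j\<close>th derivative; only its values at dyadic points matter.\<close>

locale dyadic_jets =
  fixes F :: "nat \<Rightarrow> real \<Rightarrow> real"
  assumes locally_bounded: "\<And>j R. \<exists>B. \<forall>d\<in>dyadics. \<bar>d\<bar> \<le> real R \<longrightarrow> \<bar>F j d\<bar> \<le> B"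
    and diff_quotients: "\<And>j R \<epsilon>. 0 < \<epsilon> \<Longrightarrow> \<exists>n0. \<forall>n\<ge>n0. \<forall>k::int. \<bar>k\<bar> \<le> int R * 2 ^ n \<longrightarrow>
      \<bar>2 ^ n * (F j ((real_of_int k + 1) / 2 ^ n) - F j (real_of_int k / 2 ^ n)) - F (Suc j) (real_of_int k / 2 ^ n)\<bar> \<le> \<epsilon>"
begin

text \<open>No derivative exists yet, so the mean value inequality is obtained by telescoping over a
  fine grid that contains a and b: each cell contributes at most (\<delta> + \<epsilon>) / 2^n, and
  the discretization error \<epsilon> is removed at the end. With c = 0 this gives Lipschitz bounds,
  with c a value of the next derivative it gives differentiability.\<close>

lemma dyadic_mean_value:
  assumes "a \<in> dyadics" "b \<in> dyadics" "a \<le> b"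
    and c: "\<And>d. d \<in> dyadics \<Longrightarrow> a \<le> d \<Longrightarrow> d \<le> b \<Longrightarrow> \<bar>F (Suc j) d - c\<bar> \<le> \<delta>"
  shows "\<bar>F j b - F j a - (b - a) * c\<bar> \<le> (b - a) * \<delta>"
proof (rule field_le_epsilon)
  fix e :: real assume "0 < e"
  \<comment> \<open>The extra 1 in the denominator keeps \<epsilon> positive when a = b.\<close>
  define \<epsilon> where "\<epsilon> = e / (b - a + 1)"
  have \<epsilon>: "0 < \<epsilon>" "(b - a) * \<epsilon> \<le> e"
    using \<open>0 < e\<close> \<open>a \<le> b\<close> by (auto simp: \<epsilon>_def field_simps)
  obtain k m l m' where k: "a = real_of_int k / 2 ^ m" and l: "b = real_of_int l / 2 ^ m'"
    using assms(1,2) by (auto simp: dyadics_def)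
  obtain R :: nat where R: "max \<bar>a\<bar> \<bar>b\<bar> \<le> real R" using real_arch_simple by blast
  obtain n0 where n0: "\<And>n k. n0 \<le> n \<Longrightarrow> \<bar>k\<bar> \<le> int R * 2 ^ n \<Longrightarrow>
      \<bar>2 ^ n * (F j ((real_of_int k + 1) / 2 ^ n) - F j (real_of_int k / 2 ^ n)) - F (Suc j) (real_of_int k / 2 ^ n)\<bar> \<le> \<epsilon>"
    using diff_quotients[OF \<epsilon>(1), of R j] by metis
  define n where "n = max n0 (max m m')"
  define K where "K = k * 2 ^ (n - m)"
  define L where "L = l * 2 ^ (n - m')"
  have a: "a = real_of_int K / 2 ^ n" and b: "b = real_of_int L / 2 ^ n"
    unfolding k l K_def L_def by (intro dyadic_refine; simp add: n_def)+
  have "K \<le> L" using \<open>a \<le> b\<close> by (simp add: a b divide_le_cancel)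
  have "i \<le> L \<longrightarrow> \<bar>F j (real_of_int i / 2 ^ n) - F j a - (real_of_int i / 2 ^ n - a) * c\<bar>
      \<le> (real_of_int i / 2 ^ n - a) * (\<delta> + \<epsilon>)" if "K \<le> i" for i
    using that
  proof (induction i rule: int_ge_induct)
    case base
    then show ?case by (simp add: a)
  next
    case (step i)
    show ?case
    proof
      assume "i + 1 \<le> L"
      let ?d = "real_of_int i / 2 ^ n"
      have d: "?d \<in> dyadics" "a \<le> ?d" "?d \<le> b"
        using step.hyps \<open>i + 1 \<le> L\<close> unfolding a b by (auto simp: dyadics_def divide_le_cancel)
      have "\<bar>?d\<bar> \<le> R" using d R by auto
      then have "real_of_int \<bar>i\<bar> \<le> R * 2 ^ n" by (simp add: abs_divide divide_le_eq)
      also have "\<dots> = real_of_int (int R * 2 ^ n)" by simp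
      finally have "\<bar>i\<bar> \<le> int R * 2 ^ n" by (simp only: of_int_le_iff)
      from n0[OF _ this] have "\<bar>2 ^ n * (F j ((real_of_int i + 1) / 2 ^ n) - F j ?d) - F (Suc j) ?d\<bar> \<le> \<epsilon>"
        by (simp add: n_def)
      with c[OF d] have "\<bar>2 ^ n * (F j ((real_of_int i + 1) / 2 ^ n) - F j ?d) - c\<bar> \<le> \<delta> + \<epsilon>" by linarith
      then have "\<bar>2 ^ n * (F j ((real_of_int i + 1) / 2 ^ n) - F j ?d) - c\<bar> / 2 ^ n \<le> (\<delta> + \<epsilon>) / 2 ^ n"
        by (intro divide_right_mono) auto
      also have "\<bar>2 ^ n * (F j ((real_of_int i + 1) / 2 ^ n) - F j ?d) - c\<bar> / 2 ^ n =
          \<bar>(2 ^ n * (F j ((real_of_int i + 1) / 2 ^ n) - F j ?d) - c) / 2 ^ n\<bar>" by (simp add: abs_divide)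
      also have "(2 ^ n * (F j ((real_of_int i + 1) / 2 ^ n) - F j ?d) - c) / 2 ^ n =
          F j ((real_of_int i + 1) / 2 ^ n) - F j ?d - c / 2 ^ n" by (simp add: diff_divide_distrib)
      finally show "\<bar>F j (real_of_int (i + 1) / 2 ^ n) - F j a - (real_of_int (i + 1) / 2 ^ n - a) * c\<bar>
          \<le> (real_of_int (i + 1) / 2 ^ n - a) * (\<delta> + \<epsilon>)"
        using step.IH \<open>i + 1 \<le> L\<close> by (simp add: add_divide_distrib algebra_simps)
    qed
  qed
  from this[OF \<open>K \<le> L\<close>] have "\<bar>F j b - F j a - (b - a) * c\<bar> \<le> (b - a) * (\<delta> + \<epsilon>)" by (simp flip: b)
  also have "\<dots> \<le> (b - a) * \<delta> + e" using \<epsilon>(2) by (simp add: algebra_simps)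
  finally show "\<bar>F j b - F j a - (b - a) * c\<bar> \<le> (b - a) * \<delta> + e" .
qed

lemma dyadic_lipschitz:
  obtains B where "\<And>a b. \<lbrakk>a \<in> dyadics; b \<in> dyadics; \<bar>a\<bar> \<le> real R; \<bar>b\<bar> \<le> real R\<rbrakk> \<Longrightarrow> \<bar>F j b - F j a\<bar> \<le> \<bar>b - a\<bar> * B"
proof -
  obtain B where B: "\<And>d. d \<in> dyadics \<Longrightarrow> \<bar>d\<bar> \<le> real R \<Longrightarrow> \<bar>F (Suc j) d\<bar> \<le> B"
    using locally_bounded[of R "Suc j"] by auto
  have *: "\<bar>F j b - F j a\<bar> \<le> (b - a) * B"
    if "a \<in> dyadics" "b \<in> dyadics" "\<bar>a\<bar> \<le> real R" "\<bar>b\<bar> \<le> real R" "a \<le> b" for a b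
    using dyadic_mean_value[of a b j 0 B] that B by auto
  show ?thesis
  proof (rule that[of B])
    fix a b :: real assume "a \<in> dyadics" "b \<in> dyadics" "\<bar>a\<bar> \<le> real R" "\<bar>b\<bar> \<le> real R"
    then show "\<bar>F j b - F j a\<bar> \<le> \<bar>b - a\<bar> * B"
      using *[of a b] *[of b a] by (cases "a \<le> b") (auto simp: abs_minus_commute)
  qed
qed

text \<open>The extension of \<open>F j\<close> by continuity, written along one fixed approximating
  sequence. The same expression defines the modification in \<open>smooth_modification\<close>,
  where it makes measurability in the sample point immediate.\<close>

definition limit_fun :: "nat \<Rightarrow> real \<Rightarrow> real" where
  "limit_fun j x = lim (\<lambda>n. F j (dyadic_floor n x))"

lemma tendsto_limit_fun: "(\<lambda>n. F j (dyadic_floor n x)) \<longlonglongrightarrow> limit_fun j x"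
proof -
  obtain R :: nat where R: "\<bar>x\<bar> + 1 \<le> real R" using real_arch_simple by blast
  obtain B where B: "\<And>a b. \<lbrakk>a \<in> dyadics; b \<in> dyadics; \<bar>a\<bar> \<le> real R; \<bar>b\<bar> \<le> real R\<rbrakk> \<Longrightarrow>
      \<bar>F j b - F j a\<bar> \<le> \<bar>b - a\<bar> * B"
    using dyadic_lipschitz by blast
  have bd: "\<bar>dyadic_floor n x\<bar> \<le> real R" for n
  proof -
    have "(1::real) / 2 ^ n \<le> 1" by simp
    then show ?thesis using dyadic_floor_le[of n x] dyadic_floor_ge[of x n] R by linarith
  qed
  have "Cauchy (\<lambda>n. F j (dyadic_floor n x))"
  proof (rule metric_CauchyI)
    fix e :: real assume "0 < e"
    have "Cauchy (\<lambda>n. dyadic_floor n x)"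
      using dyadic_floor_tendsto LIMSEQ_imp_Cauchy by blast
    \<comment> \<open>No sign of \<open>B\<close> is known and it may be 0, hence the divisor |B| +
      1.\<close>
    then obtain M where M: "\<And>m n. m \<ge> M \<Longrightarrow> n \<ge> M \<Longrightarrow> dist (dyadic_floor m x) (dyadic_floor n x) < e / (\<bar>B\<bar> + 1)"
      using metric_CauchyD[of "\<lambda>n. dyadic_floor n x" "e / (\<bar>B\<bar> + 1)"] \<open>0 < e\<close> by fastforce
    show "\<exists>M. \<forall>m\<ge>M. \<forall>n\<ge>M. dist (F j (dyadic_floor m x)) (F j (dyadic_floor n x)) < e"
    proof (intro exI[of _ M] allI impI)
      fix m n assume "M \<le> m" "M \<le> n"
      have "dist (F j (dyadic_floor m x)) (F j (dyadic_floor n x)) \<le> dist (dyadic_floor m x) (dyadic_floor n x) * B"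
        using B bd by (simp add: dist_real_def)
      also have "\<dots> \<le> dist (dyadic_floor m x) (dyadic_floor n x) * (\<bar>B\<bar> + 1)"
        by (intro mult_left_mono) auto
      also have "\<dots> < e" using M[OF \<open>M \<le> m\<close> \<open>M \<le> n\<close>] by (simp add: field_simps)
      finally show "dist (F j (dyadic_floor m x)) (F j (dyadic_floor n x)) < e" .
    qed
  qed
  then show ?thesis
    unfolding limit_fun_def using Cauchy_convergent convergent_LIMSEQ_iff by blast
qed

lemma limit_fun_dyadic: "d \<in> dyadics \<Longrightarrow> limit_fun j d = F j d"
proof -
  assume "d \<in> dyadics"
  then obtain k m where d: "d = real_of_int k / 2 ^ m" by (auto simp: dyadics_def)
  have "\<forall>\<^sub>F n in sequentially. F j (dyadic_floor n d) = F j d"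
    using dyadic_floor_dyadic d by (intro eventually_sequentiallyI[of m]) simp
  then have "(\<lambda>n. F j (dyadic_floor n d)) \<longlonglongrightarrow> F j d" by (rule tendsto_eventually)
  then show ?thesis using tendsto_limit_fun LIMSEQ_unique by blast
qed

text \<open>The dyadic approximations of x come from the left, so the hypothesis has to reach a
  little below x; \<eta> is this margin. Points above y are never visited.\<close>

lemma limit_fun_mean_value:
  assumes "x \<le> y" "0 < \<eta>"
    and c: "\<And>d. d \<in> dyadics \<Longrightarrow> x - \<eta> \<le> d \<Longrightarrow> d \<le> y \<Longrightarrow> \<bar>F (Suc j) d - c\<bar> \<le> \<delta>"
  shows "\<bar>limit_fun j y - limit_fun j x - (y - x) * c\<bar> \<le> (y - x) * \<delta>"
proof (rule tendsto_le)
  show "(\<lambda>n. \<bar>F j (dyadic_floor n y) - F j (dyadic_floor n x) - (dyadic_floor n y - dyadic_floor n x) * c\<bar>)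
      \<longlonglongrightarrow> \<bar>limit_fun j y - limit_fun j x - (y - x) * c\<bar>"
    by (intro tendsto_intros tendsto_limit_fun dyadic_floor_tendsto)
  show "(\<lambda>n. (dyadic_floor n y - dyadic_floor n x) * \<delta>) \<longlonglongrightarrow> (y - x) * \<delta>"
    by (intro tendsto_intros dyadic_floor_tendsto)
  have "\<forall>\<^sub>F n in sequentially. (1::real) / 2 ^ n < \<eta>"
    using inverse_power_2_tendsto_zero \<open>0 < \<eta>\<close> by (rule order_tendstoD)
  then show "\<forall>\<^sub>F n in sequentially.
      \<bar>F j (dyadic_floor n y) - F j (dyadic_floor n x) - (dyadic_floor n y - dyadic_floor n x) * c\<bar>
      \<le> (dyadic_floor n y - dyadic_floor n x) * \<delta>"
  proof eventually_elim
    case (elim n)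
    show ?case
    proof (rule dyadic_mean_value)
      fix d assume "d \<in> dyadics" "dyadic_floor n x \<le> d" "d \<le> dyadic_floor n y"
      then show "\<bar>F (Suc j) d - c\<bar> \<le> \<delta>"
        using elim dyadic_floor_ge[of x n] dyadic_floor_le[of n y] by (intro c) auto
    qed (auto intro: dyadic_floor_mono \<open>x \<le> y\<close>)
  qed
qed auto

lemma limit_fun_mean_value_ball:
  assumes "0 < \<eta>" "\<bar>y - x\<bar> < \<eta>"
    and c: "\<And>d. d \<in> dyadics \<Longrightarrow> \<bar>d - x\<bar> < \<eta> \<Longrightarrow> \<bar>F (Suc j) d - c\<bar> \<le> \<delta>"
  shows "\<bar>limit_fun j y - limit_fun j x - (y - x) * c\<bar> \<le> \<bar>y - x\<bar> * \<delta>"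
proof (cases "x \<le> y")
  case True
  have "\<bar>limit_fun j y - limit_fun j x - (y - x) * c\<bar> \<le> (y - x) * \<delta>"
    by (rule limit_fun_mean_value[of _ _ "\<eta> / 2"]) (use True assms in auto)
  with True show ?thesis by simp
next
  case False
  have "\<bar>limit_fun j x - limit_fun j y - (x - y) * c\<bar> \<le> (x - y) * \<delta>"
    \<comment> \<open>Here y is the left endpoint, and half of its distance to the edge of the ball
      around x serves as margin.\<close>
    by (rule limit_fun_mean_value[of _ _ "(\<eta> - \<bar>y - x\<bar>) / 2"]) (use False assms in \<open>auto simp: abs_real_def field_simps\<close>)
  moreover have "limit_fun j x - limit_fun j y - (x - y) * c = - (limit_fun j y - limit_fun j x - (y - x) * c)"
    by (simp add: algebra_simps)
  ultimately show ?thesis using False by simp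
qed

lemma isCont_limit_fun: "isCont (limit_fun j) x"
proof -
  obtain R :: nat where R: "\<bar>x\<bar> + 1 \<le> real R" using real_arch_simple by blast
  obtain B where B: "\<And>d. d \<in> dyadics \<Longrightarrow> \<bar>d\<bar> \<le> real R \<Longrightarrow> \<bar>F (Suc j) d\<bar> \<le> B"
    using locally_bounded[of R "Suc j"] by auto
  have "\<forall>\<^sub>F y in at x. \<bar>y - x\<bar> < 1"
    by (auto simp: eventually_at dist_real_def intro!: exI[of _ 1])
  then have "\<forall>\<^sub>F y in at x. norm (limit_fun j y - limit_fun j x) \<le> \<bar>y - x\<bar> * B"
  proof eventually_elim
    case (elim y)
    show ?case using limit_fun_mean_value_ball[of 1 y x j 0 B] elim B R by force
  qed
  moreover have "((\<lambda>y. \<bar>y - x\<bar> * B) \<longlongrightarrow> 0) (at x)"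
    by (auto intro!: tendsto_eq_intros)
  ultimately have "((\<lambda>y. limit_fun j y - limit_fun j x) \<longlongrightarrow> 0) (at x)"
    by (rule Lim_null_comparison)
  then show ?thesis unfolding isCont_def by (rule LIM_zero_cancel)
qed

text \<open>The mean value inequality with c = \<open>limit_fun (Suc j) x\<close>. Dyadic values of
  \<open>F (Suc j)\<close> are values of \<open>limit_fun (Suc j)\<close>, and continuity of the
  latter keeps them within e of c near x.\<close>

lemma limit_fun_has_derivative: "(limit_fun j has_real_derivative limit_fun (Suc j) x) (at x)"
  unfolding has_field_derivative_def has_derivative_within_alt
proof (intro conjI allI impI)
  fix e :: real assume "0 < e"
  then obtain \<eta> where \<eta>: "\<eta> > 0" "\<And>y. dist y x < \<eta> \<Longrightarrow> dist (limit_fun (Suc j) y) (limit_fun (Suc j) x) < e"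
    using isCont_limit_fun[where j="Suc j" and x=x] unfolding continuous_at_eps_delta by (metis dist_commute)
  have "\<bar>limit_fun j y - limit_fun j x - (y - x) * limit_fun (Suc j) x\<bar> \<le> \<bar>y - x\<bar> * e" if "\<bar>y - x\<bar> < \<eta>" for y
    by (rule limit_fun_mean_value_ball[of \<eta>])
       (use \<eta> that in \<open>auto simp: dist_real_def less_imp_le simp flip: limit_fun_dyadic\<close>)
  then show "\<exists>d>0. \<forall>y\<in>UNIV. norm (y - x) < d \<longrightarrow>
      norm (limit_fun j y - limit_fun j x - limit_fun (Suc j) x * (y - x)) \<le> e * norm (y - x)"
    using \<open>\<eta> > 0\<close> by (intro exI[of _ \<eta>]) (auto simp: mult.commute)
qed (rule bounded_linear_mult_right)

lemma limit_fun_C_infinity: "limit_fun 0 \<in> C_infinity"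
proof -
  have "(deriv ^^ n) (limit_fun 0) = limit_fun n" for n
    by (induction n) (auto intro!: DERIV_imp_deriv limit_fun_has_derivative)
  then show ?thesis
    unfolding C_infinity_def field_differentiable_def using limit_fun_has_derivative by auto
qed

end

section \<open>Spectrally dominated fields\<close>

text \<open>A list of pairs (a, x) stands for the finitely supported signed measure with mass a at
  x; repeated points are allowed, so sums are concatenations. \<open>trig_poly\<close> is its
  Fourier transform, \<open>lin_comb\<close> the integral of the field against it.\<close>

definition trig_poly :: "(real \<times> real) list \<Rightarrow> real \<Rightarrow> complex" where
  "trig_poly l \<xi> = (\<Sum>(a, x)\<leftarrow>l. complex_of_real a * cis (\<xi> * x))"

definition lin_comb :: "(real \<Rightarrow> 'b \<Rightarrow> real) \<Rightarrow> (real \<times> real) list \<Rightarrow> 'b \<Rightarrow> real" where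
  "lin_comb S l \<omega> = (\<Sum>(a, x)\<leftarrow>l. a * S x \<omega>)"

lemma trig_poly_simps[simp]:
  "trig_poly [] \<xi> = 0"
  "trig_poly ((a, x) # l) \<xi> = complex_of_real a * cis (\<xi> * x) + trig_poly l \<xi>"
  by (simp_all add: trig_poly_def)

lemma lin_comb_simps[simp]:
  "lin_comb S [] \<omega> = 0"
  "lin_comb S ((a, x) # l) \<omega> = a * S x \<omega> + lin_comb S l \<omega>"
  by (simp_all add: lin_comb_def)

lemma lin_comb_fun:
  "lin_comb S [] = (\<lambda>\<omega>. 0)"
  "lin_comb S ((a, x) # l) = (\<lambda>\<omega>. a * S x \<omega> + lin_comb S l \<omega>)"
  by (simp_all add: fun_eq_iff)

lemma measurable_trig_poly[measurable]: "trig_poly l \<in> borel_measurable borel"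
proof -
  have "continuous_on UNIV (\<lambda>\<xi>. trig_poly l \<xi>)"
  proof (induction l)
    case (Cons p l)
    then show ?case by (cases p) (auto intro!: continuous_intros simp: cis_conv_exp)
  qed simp
  then show ?thesis by (simp add: borel_measurable_continuous_onI)
qed

lemma measurable_lin_comb[measurable]:
  assumes [measurable]: "\<And>x. S x \<in> borel_measurable N"
  shows "lin_comb S l \<in> borel_measurable N"
  unfolding lin_comb_def by (induction l) auto

lemma norm_cis_minus_1_le: "cmod (cis \<theta> - 1) \<le> \<bar>\<theta>\<bar>"
  using iexp_approx1[of \<theta> 0] by (simp add: cis_conv_exp)

lemma norm_cis_minus_linear_le: "cmod (cis \<theta> - 1 - \<i> * \<theta>) \<le> \<theta>\<^sup>2 / 2"
  using iexp_approx1[of \<theta> 1] by (simp add: cis_conv_exp numeral_2_eq_2 algebra_simps)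

text \<open>A process dominated by a stationary one with spectral density \<open>w\<close>. Asking only for an
  inequality makes the condition stable under almost sure limits, by Fatou's lemma.\<close>

locale spectrally_dominated =
  fixes N :: "'b measure" and w :: "real \<Rightarrow> real" and S :: "real \<Rightarrow> 'b \<Rightarrow> real"
  assumes measurable_field[measurable]: "\<And>x. S x \<in> borel_measurable N"
    and measurable_density[measurable]: "w \<in> borel_measurable borel"
    and density_nonneg: "\<And>\<xi>. 0 \<le> w \<xi>"
    and moments: "\<And>k. (\<integral>\<^sup>+\<xi>. ennreal (\<xi> ^ (2 * k) * w \<xi>) \<partial>lborel) < \<infinity>"
    and dominated: "\<And>l. (\<integral>\<^sup>+\<omega>. ennreal ((lin_comb S l \<omega>)\<^sup>2) \<partial>N) \<le>
      (\<integral>\<^sup>+\<xi>. ennreal ((cmod (trig_poly l \<xi>))\<^sup>2 * w \<xi>) \<partial>lborel)"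
begin

definition moment :: "nat \<Rightarrow> real" where
  "moment k = enn2real (\<integral>\<^sup>+\<xi>. ennreal (\<xi> ^ (2 * k) * w \<xi>) \<partial>lborel)"

lemma moment_nonneg: "0 \<le> moment k" by (simp add: moment_def)

text \<open>The transfer principle: a bound of order |\<xi>|^k on the trigonometric polynomial
  becomes a mean square bound on the field, paid for by \<open>moment k\<close>. Increments use k =
  1, differences of difference quotients k = 2.\<close>

lemma lin_comb_le_moment:
  assumes "0 \<le> c" and le: "\<And>\<xi>. cmod (trig_poly l \<xi>) \<le> c * \<bar>\<xi>\<bar> ^ k"
  shows "(\<integral>\<^sup>+\<omega>. ennreal ((lin_comb S l \<omega>)\<^sup>2) \<partial>N) \<le> ennreal (c\<^sup>2 * moment k)"
proof -
  have "(cmod (trig_poly l \<xi>))\<^sup>2 * w \<xi> \<le> c\<^sup>2 * (\<xi> ^ (2 * k) * w \<xi>)" for \<xi>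
  proof -
    have "(cmod (trig_poly l \<xi>))\<^sup>2 \<le> (c * \<bar>\<xi>\<bar> ^ k)\<^sup>2" by (intro power_mono le) auto
    also have "\<dots> = c\<^sup>2 * \<xi> ^ (2 * k)"
      by (simp add: power_mult_distrib power_even_eq flip: power_abs)
    finally show ?thesis using density_nonneg[of \<xi>] by (simp add: mult_right_mono flip: mult.assoc)
  qed
  then have "(\<integral>\<^sup>+\<xi>. ennreal ((cmod (trig_poly l \<xi>))\<^sup>2 * w \<xi>) \<partial>lborel) \<le>
      (\<integral>\<^sup>+\<xi>. ennreal (c\<^sup>2) * ennreal (\<xi> ^ (2 * k) * w \<xi>) \<partial>lborel)"
    by (intro nn_integral_mono) (simp flip: ennreal_mult' add: ennreal_leI)
  also have "\<dots> = ennreal (c\<^sup>2) * (\<integral>\<^sup>+\<xi>. ennreal (\<xi> ^ (2 * k) * w \<xi>) \<partial>lborel)"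
    by (rule nn_integral_cmult) measurable
  also have "\<dots> = ennreal (c\<^sup>2 * moment k)"
    using moments[of k] by (simp add: moment_def ennreal_mult' less_top)
  finally show ?thesis using dominated[of l] by (rule order_trans[rotated])
qed

lemma increment_le:
  "(\<integral>\<^sup>+\<omega>. ennreal ((S y \<omega> - S x \<omega>)\<^sup>2) \<partial>N) \<le> ennreal ((y - x)\<^sup>2 * moment 1)"
proof -
  have "cmod (trig_poly [(1, y), (-1, x)] \<xi>) \<le> \<bar>y - x\<bar> * \<bar>\<xi>\<bar> ^ 1" for \<xi>
  proof -
    have "trig_poly [(1, y), (-1, x)] \<xi> = cis (\<xi> * x) * (cis (\<xi> * (y - x)) - 1)"
      by (simp add: right_diff_distrib cis_mult)
    then show ?thesis using norm_cis_minus_1_le[of "\<xi> * (y - x)"]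
      by (simp add: norm_mult abs_mult mult.commute)
  qed
  from lin_comb_le_moment[OF _ this] show ?thesis by simp
qed

definition diff_quotient :: "nat \<Rightarrow> real \<Rightarrow> 'b \<Rightarrow> real" where
  "diff_quotient n x \<omega> = 2 ^ n * (S (x + 1 / 2 ^ n) \<omega> - S x \<omega>)"

lemma measurable_diff_quotient[measurable]: "diff_quotient n x \<in> borel_measurable N"
  unfolding diff_quotient_def by measurable

text \<open>After the unimodular factor cis(\<xi> x) is taken out, which makes the bound uniform in
  x, the quotient of step 2^-p has symbol 2^p (cis(\<xi> / 2^p) - 1). By Taylor's formula it lies
  within \<xi>^2 / 2^(p+1) of i \<xi>, so two symbols with m \<le> n differ by at most \<xi>^2 /
  2^m.\<close>

lemma diff_quotient_diff_le:
  assumes "m \<le> n"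
  shows "(\<integral>\<^sup>+\<omega>. ennreal ((diff_quotient m x \<omega> - diff_quotient n x \<omega>)\<^sup>2) \<partial>N) \<le> ennreal (moment 2 * (1/4) ^ m)"
proof -
  let ?l = "[(2 ^ m, x + 1 / 2 ^ m), (- (2 ^ m), x), (- (2 ^ n), x + 1 / 2 ^ n), (2 ^ n, x)]"
  have q: "cmod (2 ^ p * (cis (\<xi> / 2 ^ p) - 1) - \<i> * \<xi>) \<le> \<xi>\<^sup>2 / 2 / 2 ^ p" for p \<xi>
  proof -
    have "2 ^ p * (cis (\<xi> / 2 ^ p) - 1) - \<i> * \<xi> = 2 ^ p * (cis (\<xi> / 2 ^ p) - 1 - \<i> * complex_of_real (\<xi> / 2 ^ p))"
      by (simp add: algebra_simps)
    then have "cmod (2 ^ p * (cis (\<xi> / 2 ^ p) - 1) - \<i> * \<xi>) = 2 ^ p * cmod (cis (\<xi> / 2 ^ p) - 1 - \<i> * complex_of_real (\<xi> / 2 ^ p))"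
      by (simp only: norm_mult norm_power) simp
    also have "\<dots> \<le> 2 ^ p * ((\<xi> / 2 ^ p)\<^sup>2 / 2)"
      by (intro mult_left_mono norm_cis_minus_linear_le) auto
    also have "\<dots> = \<xi>\<^sup>2 / 2 / 2 ^ p" by (simp add: power2_eq_square)
    finally show ?thesis .
  qed
  have "cmod (trig_poly ?l \<xi>) \<le> 1 / 2 ^ m * \<bar>\<xi>\<bar> ^ 2" for \<xi>
  proof -
    have "trig_poly ?l \<xi> = cis (\<xi> * x) *
        ((2 ^ m * (cis (\<xi> / 2 ^ m) - 1) - \<i> * \<xi>) - (2 ^ n * (cis (\<xi> / 2 ^ n) - 1) - \<i> * \<xi>))"
      by (simp add: algebra_simps flip: cis_mult)
    then have "cmod (trig_poly ?l \<xi>) = cmod ((2 ^ m * (cis (\<xi> / 2 ^ m) - 1) - \<i> * \<xi>) - (2 ^ n * (cis (\<xi> / 2 ^ n) - 1) - \<i> * \<xi>))"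
      by (simp only: norm_mult norm_cis mult_1_left)
    also have "\<dots> \<le> \<xi>\<^sup>2 / 2 / 2 ^ m + \<xi>\<^sup>2 / 2 / 2 ^ n"
      by (intro order_trans[OF norm_triangle_ineq4] add_mono q)
    also have "\<dots> \<le> \<xi>\<^sup>2 / 2 / 2 ^ m + \<xi>\<^sup>2 / 2 / 2 ^ m"
      using assms by (intro add_left_mono divide_left_mono) auto
    finally show ?thesis by simp
  qed
  from lin_comb_le_moment[OF _ this]
  have "(\<integral>\<^sup>+\<omega>. ennreal ((lin_comb S ?l \<omega>)\<^sup>2) \<partial>N) \<le> ennreal ((1 / 2 ^ m)\<^sup>2 * moment 2)" by simp
  also have "(1 / 2 ^ m)\<^sup>2 * moment 2 = moment 2 * (1/4) ^ m"
    by (simp only: inverse_power_2_square mult.commute)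
  finally show ?thesis by (simp add: diff_quotient_def algebra_simps)
qed

definition derivative_field :: "real \<Rightarrow> 'b \<Rightarrow> real" where
  "derivative_field x \<omega> = lim (\<lambda>n. diff_quotient n x \<omega>)"

lemma AE_diff_quotient_tendsto:
  "AE \<omega> in N. (\<lambda>n. diff_quotient n x \<omega>) \<longlonglongrightarrow> derivative_field x \<omega>"
proof -
  have "AE \<omega> in N. convergent (\<lambda>n. diff_quotient n x \<omega>)"
  proof (rule AE_convergent_of_L2_geometric[OF _ moment_nonneg[of 2]])
    show "(\<integral>\<^sup>+\<omega>. ennreal ((diff_quotient (Suc n) x \<omega> - diff_quotient n x \<omega>)\<^sup>2) \<partial>N) \<le> ennreal (moment 2 * (1/4) ^ n)" for n
      using diff_quotient_diff_le[of n "Suc n" x] by (subst power2_commute) simp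
  qed measurable
  then show ?thesis by eventually_elim (simp add: derivative_field_def convergent_LIMSEQ_iff)
qed

lemma diff_quotient_minus_derivative_le:
  "(\<integral>\<^sup>+\<omega>. ennreal ((diff_quotient m x \<omega> - derivative_field x \<omega>)\<^sup>2) \<partial>N) \<le> ennreal (moment 2 * (1/4) ^ m)"
proof (rule nn_integral_le_of_tendsto)
  show "AE \<omega> in N. (\<lambda>n. diff_quotient m x \<omega> - diff_quotient n x \<omega>) \<longlonglongrightarrow> diff_quotient m x \<omega> - derivative_field x \<omega>"
    using AE_diff_quotient_tendsto[of x] by eventually_elim (intro tendsto_intros)
qed (auto intro!: eventually_sequentiallyI[of m] diff_quotient_diff_le)

text \<open>Already the difference quotients are dominated with weight \<xi>^2 w, because |2^n
  (cis(\<xi> / 2^n) - 1)| \<le> |\<xi>|; the bound passes to the limit. The new weight has all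
  moments since its moment k is the old moment k + 1, so the construction can be iterated.\<close>

lemma spectrally_dominated_derivative:
  "spectrally_dominated N (\<lambda>\<xi>. \<xi>\<^sup>2 * w \<xi>) derivative_field"
proof
  show [measurable]: "derivative_field x \<in> borel_measurable N" for x
    unfolding derivative_field_def by measurable
  show "(\<integral>\<^sup>+\<xi>. ennreal (\<xi> ^ (2 * k) * (\<xi>\<^sup>2 * w \<xi>)) \<partial>lborel) < \<infinity>" for k
    using moments[of "Suc k"] by (simp add: power2_eq_square mult_ac)
  fix l :: "(real \<times> real) list"
  \<comment> \<open>Every entry (a, x) becomes the two entries of its difference quotient, so that
    combinations of quotients are combinations of \<open>S\<close> and \<open>dominated\<close>
    applies to them.\<close>
  define l' where "l' n = map (\<lambda>(a, x). (a * 2 ^ n, x + 1 / 2 ^ n)) l @ map (\<lambda>(a, x). (- (a * 2 ^ n), x)) l" for n :: nat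
  have comb: "lin_comb S (l' n) \<omega> = lin_comb (diff_quotient n) l \<omega>" for n \<omega>
    unfolding l'_def lin_comb_def by (induction l) (auto simp: diff_quotient_def algebra_simps)
  have trig: "trig_poly (l' n) \<xi> = trig_poly l \<xi> * (2 ^ n * (cis (\<xi> / 2 ^ n) - 1))" for n \<xi>
    unfolding l'_def trig_poly_def by (induction l) (auto simp: algebra_simps simp flip: cis_mult)
  show "(\<integral>\<^sup>+\<omega>. ennreal ((lin_comb derivative_field l \<omega>)\<^sup>2) \<partial>N) \<le>
      (\<integral>\<^sup>+\<xi>. ennreal ((cmod (trig_poly l \<xi>))\<^sup>2 * (\<xi>\<^sup>2 * w \<xi>)) \<partial>lborel)"
  proof (rule nn_integral_le_of_tendsto)
    show "AE \<omega> in N. (\<lambda>n. lin_comb (diff_quotient n) l \<omega>) \<longlonglongrightarrow> lin_comb derivative_field l \<omega>"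
    proof (induction l)
      case (Cons p l)
      obtain a x where p: "p = (a, x)" by (cases p)
      from Cons.IH AE_diff_quotient_tendsto[of x] show ?case
        unfolding p lin_comb_simps by eventually_elim (intro tendsto_intros)
    qed simp
    have "(\<integral>\<^sup>+\<omega>. ennreal ((lin_comb (diff_quotient n) l \<omega>)\<^sup>2) \<partial>N) \<le>
      (\<integral>\<^sup>+\<xi>. ennreal ((cmod (trig_poly l \<xi>))\<^sup>2 * (\<xi>\<^sup>2 * w \<xi>)) \<partial>lborel)" for n
    proof -
      have "(\<integral>\<^sup>+\<omega>. ennreal ((lin_comb (diff_quotient n) l \<omega>)\<^sup>2) \<partial>N) \<le>
          (\<integral>\<^sup>+\<xi>. ennreal ((cmod (trig_poly (l' n) \<xi>))\<^sup>2 * w \<xi>) \<partial>lborel)"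
        using dominated[of "l' n"] by (simp add: comb)
      also have "\<dots> \<le> (\<integral>\<^sup>+\<xi>. ennreal ((cmod (trig_poly l \<xi>))\<^sup>2 * (\<xi>\<^sup>2 * w \<xi>)) \<partial>lborel)"
      proof (intro nn_integral_mono ennreal_leI)
        fix \<xi>
        have "cmod (2 ^ n * (cis (\<xi> / 2 ^ n) - 1)) \<le> 2 ^ n * \<bar>\<xi> / 2 ^ n\<bar>"
          unfolding norm_mult norm_power using norm_cis_minus_1_le[of "\<xi> / 2 ^ n"] by (simp add: field_simps)
        then have "(cmod (2 ^ n * (cis (\<xi> / 2 ^ n) - 1)))\<^sup>2 \<le> \<xi>\<^sup>2"
          by (intro abs_le_square_iff[THEN iffD1]) (auto simp: abs_divide)
        then have "(cmod (trig_poly l \<xi>))\<^sup>2 * (cmod (2 ^ n * (cis (\<xi> / 2 ^ n) - 1)))\<^sup>2 * w \<xi>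
            \<le> (cmod (trig_poly l \<xi>))\<^sup>2 * \<xi>\<^sup>2 * w \<xi>"
          using density_nonneg by (intro mult_right_mono mult_left_mono) auto
        then show "(cmod (trig_poly (l' n) \<xi>))\<^sup>2 * w \<xi> \<le> (cmod (trig_poly l \<xi>))\<^sup>2 * (\<xi>\<^sup>2 * w \<xi>)"
          unfolding trig norm_mult[of "trig_poly l \<xi>"] power_mult_distrib by (simp add: mult.assoc)
      qed
      finally show ?thesis .
    qed
    then show "\<forall>\<^sub>F n in sequentially. (\<integral>\<^sup>+\<omega>. ennreal ((lin_comb (diff_quotient n) l \<omega>)\<^sup>2) \<partial>N) \<le>
      (\<integral>\<^sup>+\<xi>. ennreal ((cmod (trig_poly l \<xi>))\<^sup>2 * (\<xi>\<^sup>2 * w \<xi>)) \<partial>lborel)" by simp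
  qed measurable
qed (auto simp: density_nonneg)

end

section \<open>Almost sure estimates on dyadic grids\<close>

text \<open>Chaining: a point that is new at level n + 1 has an odd numerator and lies half a cell
  to the right of a point of level n, at cost (3/4)^n. The finitely many points of level n0 have a
  maximum, and all costs together are at most the geometric series with sum 4.\<close>

lemma dyadic_bounded_of_increments:
  fixes f :: "real \<Rightarrow> real"
  assumes le: "\<And>n k. n0 \<le> n \<Longrightarrow> \<bar>k\<bar> \<le> int R * 2 ^ n \<Longrightarrow>
    \<bar>f (real_of_int k / 2 ^ n + 1 / 2 ^ Suc n) - f (real_of_int k / 2 ^ n)\<bar> \<le> (3/4) ^ n"
  shows "\<exists>B. \<forall>d\<in>dyadics. \<bar>d\<bar> \<le> real R \<longrightarrow> \<bar>f d\<bar> \<le> B"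
proof -
  define B where "B = Max ((\<lambda>k. \<bar>f (real_of_int k / 2 ^ n0)\<bar>) ` {- (int R * 2 ^ n0)..int R * 2 ^ n0})"
  have level_n0: "\<bar>f (real_of_int k / 2 ^ n0)\<bar> \<le> B" if "\<bar>k\<bar> \<le> int R * 2 ^ n0" for k
    unfolding B_def using that by (intro Max_ge imageI finite_imageI) auto
  have level: "\<forall>k. \<bar>k\<bar> \<le> int R * 2 ^ n \<longrightarrow> \<bar>f (real_of_int k / 2 ^ n)\<bar> \<le> B + (\<Sum>i<n. (3/4) ^ i)" if "n0 \<le> n" for n
    using that
  proof (induction n rule: dec_induct)
    case base
    have "0 \<le> (\<Sum>i<n0. (3/4::real) ^ i)" by (intro sum_nonneg) auto
    then show ?case using level_n0 by (auto intro: add_increasing2)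
  next
    case (step n)
    show ?case
    proof (intro allI impI)
      fix k :: int assume k: "\<bar>k\<bar> \<le> int R * 2 ^ Suc n"
      define k' where "k' = k div 2"
      \<comment> \<open>Division rounds down, so -2r \<le> k \<le> 2r gives -r \<le> k div 2 \<le> r
        also for odd negative k: the left neighbour stays inside the range.\<close>
      have "\<bar>k div 2\<bar> \<le> r" if "\<bar>k\<bar> \<le> 2 * r" for r :: int using that by presburger
      then have k': "\<bar>k'\<bar> \<le> int R * 2 ^ n" using k unfolding k'_def by simp
      have IH: "\<bar>f (real_of_int k' / 2 ^ n)\<bar> \<le> B + (\<Sum>i<n. (3/4) ^ i)" using step.IH k' by blast
      have "(0::real) \<le> (3/4) ^ n" by simp
      show "\<bar>f (real_of_int k / 2 ^ Suc n)\<bar> \<le> B + (\<Sum>i<Suc n. (3/4) ^ i)"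
      proof (cases "even k")
        case True
        then have "real_of_int k / 2 ^ Suc n = real_of_int k' / 2 ^ n" unfolding k'_def by (auto elim: evenE)
        then have "\<bar>f (real_of_int k / 2 ^ Suc n)\<bar> = \<bar>f (real_of_int k' / 2 ^ n)\<bar>" by (simp only:)
        then show ?thesis using IH \<open>(0::real) \<le> (3/4) ^ n\<close> unfolding sum.lessThan_Suc by linarith
      next
        case False
        then have "k = 2 * k' + 1" unfolding k'_def by simp
        then have "real_of_int k / 2 ^ Suc n = real_of_int k' / 2 ^ n + 1 / 2 ^ Suc n"
          by (simp add: add_divide_distrib)
        then show ?thesis using IH le[OF step.hyps(1) k'] by simp
      qed
    qed
  qed
  have "\<bar>f d\<bar> \<le> B + 4" if "d \<in> dyadics" "\<bar>d\<bar> \<le> real R" for d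
  proof -
    obtain k m where d: "d = real_of_int k / 2 ^ m" using \<open>d \<in> dyadics\<close> by (auto simp: dyadics_def)
    define n where "n = max m n0"
    define K where "K = k * 2 ^ (n - m)"
    have dK: "d = real_of_int K / 2 ^ n" unfolding d K_def by (rule dyadic_refine) (simp add: n_def)
    have "real_of_int \<bar>K\<bar> \<le> real_of_int (int R * 2 ^ n)"
      using \<open>\<bar>d\<bar> \<le> real R\<close> by (simp add: dK abs_divide divide_le_eq)
    then have "\<bar>K\<bar> \<le> int R * 2 ^ n" by (simp only: of_int_le_iff)
    with level[of n] have "\<bar>f d\<bar> \<le> B + (\<Sum>i<n. (3/4) ^ i)" by (simp add: dK n_def)
    also have "(\<Sum>i<n. (3/4::real) ^ i) \<le> (\<Sum>i. (3/4) ^ i)"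
      by (intro sum_le_suminf summable_geometric) auto
    also have "(\<Sum>i. (3/4::real) ^ i) = 4" by (subst suminf_geometric) auto
    finally show ?thesis by simp
  qed
  then show ?thesis by blast
qed

text \<open>The grid on [-R, R] has at most (2R + 1) 2^n points, so the factor 1/2 in the rate q / 2
  absorbs their number and q^n is left for summability. The sum of squares over the grid tends to 0
  almost surely and dominates each of its terms, which makes n0 independent of k.\<close>

lemma AE_grid_small:
  fixes Y :: "nat \<Rightarrow> int \<Rightarrow> 'b \<Rightarrow> real"
  assumes [measurable]: "\<And>n k. Y n k \<in> borel_measurable N"
    and le: "\<And>n k. (\<integral>\<^sup>+\<omega>. ennreal ((Y n k \<omega>)\<^sup>2) \<partial>N) \<le> ennreal (C * (q / 2) ^ n)"
    and "0 \<le> C" "0 < q" "q < 1"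
  shows "AE \<omega> in N. \<forall>\<epsilon>>0. \<exists>n0. \<forall>n\<ge>n0. \<forall>k. \<bar>k\<bar> \<le> int R * 2 ^ n \<longrightarrow> \<bar>Y n k \<omega>\<bar> \<le> \<epsilon>"
proof -
  let ?K = "\<lambda>n. {- (int R * 2 ^ n)..int R * 2 ^ n}"
  have "AE \<omega> in N. summable (\<lambda>n. \<Sum>k\<in>?K n. (Y n k \<omega>)\<^sup>2)"
  proof (rule AE_summable_of_nn_integral[where c="\<lambda>n. (2 * real R + 1) * C * q ^ n"])
    fix n
    have card: "real (card (?K n)) \<le> (2 * real R + 1) * 2 ^ n"
    proof -
      have "card (?K n) = nat (2 * (int R * 2 ^ n) + 1)" by simp
      then have "real (card (?K n)) = 2 * (real R * 2 ^ n) + 1"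
        by (simp add: nat_add_distrib nat_mult_distrib nat_power_eq)
      also have "\<dots> \<le> (2 * real R + 1) * 2 ^ n" by (simp add: algebra_simps)
      finally show ?thesis .
    qed
    have "(\<integral>\<^sup>+\<omega>. ennreal (\<Sum>k\<in>?K n. (Y n k \<omega>)\<^sup>2) \<partial>N) = (\<Sum>k\<in>?K n. \<integral>\<^sup>+\<omega>. ennreal ((Y n k \<omega>)\<^sup>2) \<partial>N)"
      by (simp add: nn_integral_sum flip: sum_ennreal)
    also have "\<dots> \<le> (\<Sum>k\<in>?K n. ennreal (C * (q / 2) ^ n))" by (intro sum_mono le)
    also have "\<dots> = ennreal (real (card (?K n)) * (C * (q / 2) ^ n))"
      unfolding sum_constant using assms(3-5) by (subst ennreal_mult') (auto simp only: ennreal_of_nat_eq_real_of_nat)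
    also have "\<dots> \<le> ennreal ((2 * real R + 1) * 2 ^ n * (C * (q / 2) ^ n))"
      using assms(3-5) card by (intro ennreal_leI mult_right_mono) auto
    also have "(2 * real R + 1) * 2 ^ n * (C * (q / 2) ^ n) = (2 * real R + 1) * C * q ^ n"
      by (simp add: power_divide)
    finally show "(\<integral>\<^sup>+\<omega>. ennreal (\<Sum>k\<in>?K n. (Y n k \<omega>)\<^sup>2) \<partial>N) \<le> ennreal ((2 * real R + 1) * C * q ^ n)" .
  qed (use assms(3-5) in \<open>auto intro!: sum_nonneg summable_mult summable_geometric mult_nonneg_nonneg\<close>)
  then show ?thesis
  proof eventually_elim
    case (elim \<omega>)
    show ?case
    proof (intro allI impI)
      fix \<epsilon> :: real assume "0 < \<epsilon>"
      have "(\<lambda>n. \<Sum>k\<in>?K n. (Y n k \<omega>)\<^sup>2) \<longlonglongrightarrow> 0" using elim by (rule summable_LIMSEQ_zero)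
      then have "\<forall>\<^sub>F n in sequentially. (\<Sum>k\<in>?K n. (Y n k \<omega>)\<^sup>2) < \<epsilon>\<^sup>2"
        using \<open>0 < \<epsilon>\<close> by (intro order_tendstoD) auto
      then obtain n0 where n0: "\<And>n. n0 \<le> n \<Longrightarrow> (\<Sum>k\<in>?K n. (Y n k \<omega>)\<^sup>2) < \<epsilon>\<^sup>2"
        by (auto simp: eventually_sequentially)
      show "\<exists>n0. \<forall>n\<ge>n0. \<forall>k. \<bar>k\<bar> \<le> int R * 2 ^ n \<longrightarrow> \<bar>Y n k \<omega>\<bar> \<le> \<epsilon>"
      proof (intro exI[of _ n0] allI impI)
        fix n and k :: int assume "n0 \<le> n" and k: "\<bar>k\<bar> \<le> int R * 2 ^ n"
        have "(Y n k \<omega>)\<^sup>2 \<le> (\<Sum>k\<in>?K n. (Y n k \<omega>)\<^sup>2)"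
          using k by (intro member_le_sum) auto
        also have "\<dots> \<le> \<epsilon>\<^sup>2" using n0[OF \<open>n0 \<le> n\<close>] by simp
        finally show "\<bar>Y n k \<omega>\<bar> \<le> \<epsilon>" using \<open>0 < \<epsilon>\<close> by (simp add: abs_le_square_iff[symmetric])
      qed
    qed
  qed
qed

context spectrally_dominated
begin

lemma AE_locally_bounded:
  "AE \<omega> in N. \<forall>R. \<exists>B. \<forall>d\<in>dyadics. \<bar>d\<bar> \<le> real R \<longrightarrow> \<bar>S d \<omega>\<bar> \<le> B"
proof -
  have "AE \<omega> in N. \<exists>B. \<forall>d\<in>dyadics. \<bar>d\<bar> \<le> real R \<longrightarrow> \<bar>S d \<omega>\<bar> \<le> B" for R
  proof -
    \<comment> \<open>Increments over 2^-(n+1) have mean square O(4^-n). Scaling them by r^-n, with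
      r < 1 and r^2 > 1/2, leaves a rate below 2^-n; r = 3/4 gives (16/9) (1/4) = 4/9, which is q /
      2 for q = 8/9.\<close>
    define Y where "Y n k \<omega> = (4/3) ^ n * (S (real_of_int k / 2 ^ n + 1 / 2 ^ Suc n) \<omega> - S (real_of_int k / 2 ^ n) \<omega>)"
      for n :: nat and k :: int and \<omega>
    have "AE \<omega> in N. \<forall>\<epsilon>>0. \<exists>n0. \<forall>n\<ge>n0. \<forall>k. \<bar>k\<bar> \<le> int R * 2 ^ n \<longrightarrow> \<bar>Y n k \<omega>\<bar> \<le> \<epsilon>"
    proof (rule AE_grid_small[where C="moment 1" and q="8/9"])
      fix n k
      let ?x = "real_of_int k / 2 ^ n"
      have "((4/3) ^ n)\<^sup>2 = (16/9 :: real) ^ n"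
      proof -
        have "((4/3) ^ n)\<^sup>2 = ((4/3 :: real)\<^sup>2) ^ n" unfolding power_mult[symmetric] by (simp only: mult.commute)
        then show ?thesis by (simp add: power2_eq_square)
      qed
      then have "(\<integral>\<^sup>+\<omega>. ennreal ((Y n k \<omega>)\<^sup>2) \<partial>N) =
          ennreal ((16/9) ^ n) * (\<integral>\<^sup>+\<omega>. ennreal ((S (?x + 1 / 2 ^ Suc n) \<omega> - S ?x \<omega>)\<^sup>2) \<partial>N)"
        by (subst nn_integral_cmult[symmetric])
           (auto simp: Y_def power_mult_distrib simp flip: ennreal_mult' intro!: nn_integral_cong)
      also have "\<dots> \<le> ennreal ((16/9) ^ n) * ennreal ((?x + 1 / 2 ^ Suc n - ?x)\<^sup>2 * moment 1)"
        by (intro mult_left_mono increment_le) auto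
      also have "\<dots> = ennreal ((16/9) ^ n * ((1 / 2 ^ Suc n)\<^sup>2 * moment 1))"
        by (simp add: ennreal_mult')
      also have "\<dots> \<le> ennreal (moment 1 * (8 / 9 / 2) ^ n)"
      proof (rule ennreal_leI)
        have "(1 / 2 ^ Suc n)\<^sup>2 = (1/4 :: real) * (1/4) ^ n"
          unfolding inverse_power_2_square by simp
        then have "(16/9) ^ n * ((1 / 2 ^ Suc n)\<^sup>2 * moment 1) = 1/4 * (moment 1 * ((16/9) ^ n * (1/4) ^ n))"
          by simp
        also have "(16/9::real) ^ n * (1/4) ^ n = (8 / 9 / 2) ^ n" by (simp flip: power_mult_distrib)
        also have "1/4 * (moment 1 * (8 / 9 / 2) ^ n) \<le> moment 1 * (8 / 9 / 2) ^ n"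
          using moment_nonneg[of 1] by simp
        finally show "(16/9) ^ n * ((1 / 2 ^ Suc n)\<^sup>2 * moment 1) \<le> moment 1 * (8 / 9 / 2) ^ n" .
      qed
      finally show "(\<integral>\<^sup>+\<omega>. ennreal ((Y n k \<omega>)\<^sup>2) \<partial>N) \<le> ennreal (moment 1 * (8 / 9 / 2) ^ n)" .
    qed (auto simp: Y_def moment_nonneg)
    then show ?thesis
    proof eventually_elim
      case (elim \<omega>)
      then obtain n0 where n0: "\<And>n k. n0 \<le> n \<Longrightarrow> \<bar>k\<bar> \<le> int R * 2 ^ n \<Longrightarrow> \<bar>Y n k \<omega>\<bar> \<le> 1"
        using zero_less_one by metis
      show ?case
      proof (rule dyadic_bounded_of_increments)
        fix n and k :: int assume "n0 \<le> n" "\<bar>k\<bar> \<le> int R * 2 ^ n"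
        have "\<bar>x\<bar> \<le> (3/4) ^ n" if "\<bar>(4/3) ^ n * x\<bar> \<le> 1" for x :: real
        proof -
          have "\<bar>x\<bar> = (3/4) ^ n * \<bar>(4/3) ^ n * x\<bar>"
            by (simp add: abs_mult flip: power_mult_distrib mult.assoc)
          also have "\<dots> \<le> (3/4) ^ n * 1" using that by (intro mult_left_mono) auto
          finally show ?thesis by simp
        qed
        from this n0[OF \<open>n0 \<le> n\<close> \<open>\<bar>k\<bar> \<le> int R * 2 ^ n\<close>] show "\<bar>S (real_of_int k / 2 ^ n + 1 / 2 ^ Suc n) \<omega> - S (real_of_int k / 2 ^ n) \<omega>\<bar> \<le> (3/4) ^ n"
          unfolding Y_def by blast
      qed
    qed
  qed
  then show ?thesis by (simp add: AE_all_countable)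
qed

lemma AE_diff_quotients_small:
  "AE \<omega> in N. \<forall>R. \<forall>\<epsilon>>0. \<exists>n0. \<forall>n\<ge>n0. \<forall>k::int. \<bar>k\<bar> \<le> int R * 2 ^ n \<longrightarrow>
    \<bar>diff_quotient n (real_of_int k / 2 ^ n) \<omega> - derivative_field (real_of_int k / 2 ^ n) \<omega>\<bar> \<le> \<epsilon>"
proof -
  interpret D: spectrally_dominated N "\<lambda>\<xi>. \<xi>\<^sup>2 * w \<xi>" derivative_field
    by (rule spectrally_dominated_derivative)
  have "AE \<omega> in N. \<forall>\<epsilon>>0. \<exists>n0. \<forall>n\<ge>n0. \<forall>k::int. \<bar>k\<bar> \<le> int R * 2 ^ n \<longrightarrow>
    \<bar>diff_quotient n (real_of_int k / 2 ^ n) \<omega> - derivative_field (real_of_int k / 2 ^ n) \<omega>\<bar> \<le> \<epsilon>" for R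
    \<comment> \<open>The rate (1/4)^n is (q / 2)^n for q = 1/2.\<close>
    by (rule AE_grid_small[where C="moment 2" and q="1/2"])
       (use diff_quotient_minus_derivative_le in \<open>auto simp: moment_nonneg\<close>)
  then show ?thesis by (simp add: AE_all_countable)
qed

text \<open>Ties the limit of dyadic values back to the field itself. The null set depends on x,
  which the notion of a modification permits.\<close>

lemma AE_tendsto_dyadic_floor: "AE \<omega> in N. (\<lambda>n. S (dyadic_floor n x) \<omega>) \<longlonglongrightarrow> S x \<omega>"
proof -
  have "AE \<omega> in N. summable (\<lambda>n. (S (dyadic_floor n x) \<omega> - S x \<omega>)\<^sup>2)"
  proof (rule AE_summable_of_nn_integral[where c="\<lambda>n. (1/4) ^ n * moment 1"])
    fix n
    have "(\<integral>\<^sup>+\<omega>. ennreal ((S (dyadic_floor n x) \<omega> - S x \<omega>)\<^sup>2) \<partial>N) \<le>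
        ennreal ((dyadic_floor n x - x)\<^sup>2 * moment 1)" by (rule increment_le)
    also have "\<dots> \<le> ennreal ((1/4) ^ n * moment 1)"
    proof (intro ennreal_leI mult_right_mono moment_nonneg)
      have "(dyadic_floor n x - x)\<^sup>2 \<le> (1 / 2 ^ n)\<^sup>2"
        using dyadic_floor_le[of n x] dyadic_floor_ge[of x n]
        by (intro abs_le_square_iff[THEN iffD1]) auto
      also have "\<dots> = (1/4) ^ n" by (rule inverse_power_2_square)
      finally show "(dyadic_floor n x - x)\<^sup>2 \<le> (1/4) ^ n" .
    qed
    finally show "(\<integral>\<^sup>+\<omega>. ennreal ((S (dyadic_floor n x) \<omega> - S x \<omega>)\<^sup>2) \<partial>N) \<le> ennreal ((1/4) ^ n * moment 1)" .
  qed (auto intro!: summable_mult2 summable_geometric mult_nonneg_nonneg moment_nonneg)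
  then show ?thesis
  proof eventually_elim
    case (elim \<omega>)
    then have "(\<lambda>n. (S (dyadic_floor n x) \<omega> - S x \<omega>)\<^sup>2) \<longlonglongrightarrow> 0" by (rule summable_LIMSEQ_zero)
    then have "(\<lambda>n. S (dyadic_floor n x) \<omega> - S x \<omega>) \<longlonglongrightarrow> 0" by simp
    then show ?case by (rule LIM_zero_cancel)
  qed
qed

text \<open>Outside its locale \<open>derivative_field\<close> has the field as only parameter,
  since difference quotients do not involve the weight. This permits the recursion although the
  weight changes from one order to the next.\<close>

primrec derivative_fields :: "nat \<Rightarrow> real \<Rightarrow> 'b \<Rightarrow> real" where
  "derivative_fields 0 = S"
| "derivative_fields (Suc j) = spectrally_dominated.derivative_field (derivative_fields j)"

lemma spectrally_dominated_derivative_fields: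
  "spectrally_dominated N (\<lambda>\<xi>. (\<xi>\<^sup>2) ^ j * w \<xi>) (derivative_fields j)"
proof (induction j)
  case 0
  then show ?case by (simp add: spectrally_dominated_axioms)
next
  case (Suc j)
  from spectrally_dominated.spectrally_dominated_derivative[OF this] show ?case
    by (simp add: mult.assoc)
qed

theorem smooth_modification:
  "\<exists>Z. modification N S Z \<and> (\<forall>\<omega>\<in>space N. (\<lambda>x. Z x \<omega>) \<in> C_infinity)"
proof -
  have "AE \<omega> in N. dyadic_jets (\<lambda>j d. derivative_fields j d \<omega>)"
  proof -
    \<comment> \<open>The orders j and the radii R are countable, so all these estimates hold
      together off a single null set.\<close>
    have 1: "AE \<omega> in N. \<forall>j R. \<exists>B. \<forall>d\<in>dyadics. \<bar>d\<bar> \<le> real R \<longrightarrow> \<bar>derivative_fields j d \<omega>\<bar> \<le> B"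
      using spectrally_dominated.AE_locally_bounded[OF spectrally_dominated_derivative_fields]
      by (subst AE_all_countable) auto
    have 2: "AE \<omega> in N. \<forall>j R. \<forall>\<epsilon>>0. \<exists>n0. \<forall>n\<ge>n0. \<forall>k::int. \<bar>k\<bar> \<le> int R * 2 ^ n \<longrightarrow>
        \<bar>2 ^ n * (derivative_fields j (real_of_int k / 2 ^ n + 1 / 2 ^ n) \<omega> - derivative_fields j (real_of_int k / 2 ^ n) \<omega>)
          - derivative_fields (Suc j) (real_of_int k / 2 ^ n) \<omega>\<bar> \<le> \<epsilon>"
    proof (subst AE_all_countable, intro allI)
      fix j
      interpret D: spectrally_dominated N "\<lambda>\<xi>. (\<xi>\<^sup>2) ^ j * w \<xi>" "derivative_fields j"
        by (rule spectrally_dominated_derivative_fields)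
      show "AE \<omega> in N. \<forall>R. \<forall>\<epsilon>>0. \<exists>n0. \<forall>n\<ge>n0. \<forall>k::int. \<bar>k\<bar> \<le> int R * 2 ^ n \<longrightarrow>
        \<bar>2 ^ n * (derivative_fields j (real_of_int k / 2 ^ n + 1 / 2 ^ n) \<omega> - derivative_fields j (real_of_int k / 2 ^ n) \<omega>)
          - derivative_fields (Suc j) (real_of_int k / 2 ^ n) \<omega>\<bar> \<le> \<epsilon>"
        using D.AE_diff_quotients_small by (simp add: D.diff_quotient_def)
    qed
    from 1 2 show ?thesis
      by eventually_elim (unfold_locales, auto simp: add_divide_distrib)
  qed
  \<comment> \<open>\<open>B\<close> is a measurable null set that contains the exceptional paths.
    Putting \<open>Z\<close> equal to 0 on it keeps \<open>Z\<close> measurable and makes every path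
    smooth, not just almost every one.\<close>
  then obtain B where B: "{\<omega>\<in>space N. \<not> dyadic_jets (\<lambda>j d. derivative_fields j d \<omega>)} \<subseteq> B"
    "emeasure N B = 0" "B \<in> sets N" by (rule AE_E)
  note [measurable] = \<open>B \<in> sets N\<close>
  define Z where "Z x \<omega> = (if \<omega> \<in> B then 0 else lim (\<lambda>n. S (dyadic_floor n x) \<omega>))" for x \<omega>
  have "AE \<omega> in N. \<omega> \<notin> B" using B by (intro AE_not_in) (auto simp: null_sets_def)
  have "AE \<omega> in N. S x \<omega> = Z x \<omega>" for x
    using AE_tendsto_dyadic_floor[of x] \<open>AE \<omega> in N. \<omega> \<notin> B\<close>
    by eventually_elim (simp add: Z_def limI)
  moreover have "Z x \<in> borel_measurable N" for x unfolding Z_def by measurable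
  moreover have "(\<lambda>x. Z x \<omega>) \<in> C_infinity" if "\<omega> \<in> space N" for \<omega>
  proof (cases "\<omega> \<in> B")
    case True
    have "(deriv ^^ n) (\<lambda>x. 0) = (\<lambda>x. 0 :: real)" for n by (induction n) auto
    then show ?thesis using True by (simp add: Z_def C_infinity_def)
  next
    case False
    then interpret J: dyadic_jets "\<lambda>j d. derivative_fields j d \<omega>" using B(1) that by auto
    have "(\<lambda>x. Z x \<omega>) = J.limit_fun 0" using False by (simp add: Z_def J.limit_fun_def fun_eq_iff)
    then show ?thesis using J.limit_fun_C_infinity by simp
  qed
  ultimately show ?thesis unfolding modification_def by (intro exI[of _ Z]) auto
qed

end

section \<open>Plancherel's identity for transition densities\<close>

text \<open>Inversion is inserted for one of the two factors of f^2 and the integrals are exchanged;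
  as f is real, the inner integral over y is the conjugate of F. Integrability of f and F makes both
  bounded, which yields the square integrability and, with it, a finite value on each side.\<close>

lemma plancherel_of_inversion:
  fixes f :: "real \<Rightarrow> real" and F :: "real \<Rightarrow> complex"
  assumes f: "integrable lborel f" and F: "integrable lborel F"
    and F_eq: "\<And>\<xi>. F \<xi> = (CLBINT y. iexp (\<xi> * y) * complex_of_real (f y))"
    and f_eq: "\<And>y. f y = Re (CLBINT \<xi>. iexp (- (\<xi> * y)) * F \<xi>) / (2 * pi)"
  shows "(\<integral>\<^sup>+y. ennreal ((f y)\<^sup>2) \<partial>lborel) = (\<integral>\<^sup>+\<xi>. ennreal ((cmod (F \<xi>))\<^sup>2 / (2 * pi)) \<partial>lborel)"
proof -
  have [measurable]: "f \<in> borel_measurable borel" "F \<in> borel_measurable borel" using f F by auto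
  have F_le: "cmod (F \<xi>) \<le> (LBINT y. \<bar>f y\<bar>)" for \<xi>
    unfolding F_eq[of \<xi>] using integral_norm_bound[of lborel "\<lambda>y. iexp (\<xi> * y) * complex_of_real (f y)"]
    by (simp add: norm_mult)
  have f_le: "\<bar>f y\<bar> \<le> (LBINT \<xi>. cmod (F \<xi>))" for y
  proof -
    have "\<bar>Re (CLBINT \<xi>. iexp (- (\<xi> * y)) * F \<xi>)\<bar> \<le> cmod (CLBINT \<xi>. iexp (- (\<xi> * y)) * F \<xi>)"
      by (rule abs_Re_le_cmod)
    also have "\<dots> \<le> (LBINT \<xi>. cmod (F \<xi>))"
      using integral_norm_bound[of lborel "\<lambda>\<xi>. iexp (- (\<xi> * y)) * F \<xi>"] by (simp add: norm_mult)
    finally have *: "\<bar>Re (CLBINT \<xi>. iexp (- (\<xi> * y)) * F \<xi>)\<bar> \<le> (LBINT \<xi>. cmod (F \<xi>))" .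
    have "1 \<le> 2 * pi" using pi_gt3 by simp
    then have "\<bar>Re (CLBINT \<xi>. iexp (- (\<xi> * y)) * F \<xi>)\<bar> / (2 * pi) \<le> \<bar>Re (CLBINT \<xi>. iexp (- (\<xi> * y)) * F \<xi>)\<bar> / 1"
      by (intro divide_left_mono) auto
    with * show ?thesis unfolding f_eq[of y] by (simp add: abs_divide)
  qed
  have f_sq_le: "f y * f y \<le> (LBINT \<xi>. cmod (F \<xi>)) * \<bar>f y\<bar>" for y
    using mult_right_mono[OF f_le abs_ge_zero, of y "f y"] by simp
  have f2: "integrable lborel (\<lambda>y. (f y)\<^sup>2)"
    unfolding power2_eq_square
    by (rule Bochner_Integration.integrable_bound[of _ "\<lambda>y. (LBINT \<xi>. cmod (F \<xi>)) * \<bar>f y\<bar>"])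
       (use f f_sq_le in \<open>auto intro!: order_trans[OF _ abs_ge_self]\<close>)
  have F2: "integrable lborel (\<lambda>\<xi>. (cmod (F \<xi>))\<^sup>2)"
    unfolding power2_eq_square
    by (rule Bochner_Integration.integrable_bound[of _ "\<lambda>\<xi>. (LBINT y. \<bar>f y\<bar>) * cmod (F \<xi>)"])
       (use F F_le in \<open>auto simp: abs_mult intro!: mult_right_mono order_trans[OF _ abs_ge_self]\<close>)
  let ?h = "\<lambda>(y, \<xi>). complex_of_real (f y) * (iexp (- (\<xi> * y)) * F \<xi>)"
  have int: "integrable (lborel \<Otimes>\<^sub>M lborel) ?h"
  proof (rule lborel_pair.Fubini_integrable)
    show "integrable lborel (\<lambda>y. LBINT \<xi>. norm (?h (y, \<xi>)))"
      using f by (simp add: norm_mult)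
    have "integrable lborel (\<lambda>\<xi>. iexp (- (\<xi> * y)) * F \<xi>)" for y
      by (rule Bochner_Integration.integrable_bound[OF F]) (auto simp: norm_mult)
    then show "AE y in lborel. integrable lborel (\<lambda>\<xi>. ?h (y, \<xi>))" by auto
  qed measurable
  have "(LBINT y. (f y)\<^sup>2) = (LBINT y. Re (CLBINT \<xi>. ?h (y, \<xi>))) / (2 * pi)"
  proof -
    have "(f y)\<^sup>2 = Re (CLBINT \<xi>. ?h (y, \<xi>)) / (2 * pi)" for y
      unfolding power2_eq_square by (subst (2) f_eq) simp
    then show ?thesis by simp
  qed
  also have "(LBINT y. Re (CLBINT \<xi>. ?h (y, \<xi>))) = Re (CLBINT y. CLBINT \<xi>. ?h (y, \<xi>))"
    by (rule integral_Re) (rule lborel_pair.integrable_fst'[OF int])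
  also have "(CLBINT y. CLBINT \<xi>. ?h (y, \<xi>)) = (CLBINT \<xi>. CLBINT y. ?h (y, \<xi>))"
    using lborel_pair.Fubini_integral[OF int] by simp
  also have "\<dots> = (CLBINT \<xi>. complex_of_real ((cmod (F \<xi>))\<^sup>2))"
  proof (rule Bochner_Integration.integral_cong[OF refl])
    fix \<xi> :: real
    have "(CLBINT y. ?h (y, \<xi>)) = (CLBINT y. F \<xi> * cnj (iexp (\<xi> * y) * complex_of_real (f y)))"
      by (intro Bochner_Integration.integral_cong) (auto simp: exp_cnj)
    also have "\<dots> = F \<xi> * (CLBINT y. cnj (iexp (\<xi> * y) * complex_of_real (f y)))"
      by (rule integral_mult_right_zero)
    also have "\<dots> = F \<xi> * cnj (F \<xi>)"
      unfolding F_eq[of \<xi>] by (simp only: Bochner_Integration.integral_cnj)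
    finally show "(CLBINT y. ?h (y, \<xi>)) = complex_of_real ((cmod (F \<xi>))\<^sup>2)"
      by (simp only: complex_norm_square)
  qed
  also have "Re \<dots> = (LBINT \<xi>. (cmod (F \<xi>))\<^sup>2)"
    by (subst integral_complex_of_real) simp
  finally have "(LBINT y. (f y)\<^sup>2) = (LBINT \<xi>. (cmod (F \<xi>))\<^sup>2 / (2 * pi))" by simp
  then show ?thesis
    using f2 F2 by (simp add: nn_integral_eq_integral)
qed

lemma char_distr_translate:
  assumes [measurable]: "X \<in> borel_measurable M"
  shows "char (distr M borel (\<lambda>\<omega>. x + X \<omega>)) \<xi> = iexp (\<xi> * x) * char (distr M borel X) \<xi>"
proof -
  have "char (distr M borel (\<lambda>\<omega>. x + X \<omega>)) \<xi> = (CLINT \<omega>|M. iexp (\<xi> * x) * iexp (\<xi> * X \<omega>))"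
    by (simp add: char_def integral_distr ring_distribs exp_add)
  then show ?thesis by (simp add: char_def integral_distr)
qed

lemma char_of_density:
  assumes D: "distributed M lborel Y (\<lambda>y. ennreal (g y))" and [measurable]: "g \<in> borel_measurable borel"
    and nonneg: "\<And>y. 0 \<le> g y"
  shows "char (distr M borel Y) \<xi> = (CLBINT y. iexp (\<xi> * y) * complex_of_real (g y))"
proof -
  have "distr M borel Y = distr M lborel Y" by (rule distr_cong) auto
  also have "\<dots> = density lborel (\<lambda>y. ennreal (g y))"
    using D by (rule distributed_distr_eq_density)
  finally show ?thesis
    using nonneg by (simp add: char_def integral_density scaleR_conv_of_real mult.commute)
qed

context prob_space
begin

text \<open>Fourier inversion of the characteristic function of x + X. As an explicit integral it
  lets dominated convergence give continuity in time and both space variables.\<close>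

definition inversion_density :: "('a \<Rightarrow> real) \<Rightarrow> real \<Rightarrow> real \<Rightarrow> real" where
  "inversion_density X x y =
    Re (CLBINT \<xi>. iexp (- (\<xi> * y)) * (cis (\<xi> * x) * char (distr M borel X) \<xi>)) / (2 * pi)"

context
  fixes X :: "'a \<Rightarrow> real"
  assumes X[measurable]: "random_variable borel X"
    and char_int: "integrable lborel (char (distr M borel X))"
begin

interpretation D: real_distribution "distr M borel X" by simp

lemma integrable_trig_poly_char: "integrable lborel (\<lambda>\<xi>. trig_poly l \<xi> * char (distr M borel X) \<xi>)"
proof (induction l)
  case (Cons p l)
  obtain a x where p: "p = (a, x)" by (cases p)
  have "integrable lborel (\<lambda>\<xi>. cis (\<xi> * x) * char (distr M borel X) \<xi>)"
    by (rule Bochner_Integration.integrable_bound[OF char_int]) (auto simp: norm_mult cis_conv_exp)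
  then have "integrable lborel (\<lambda>\<xi>. complex_of_real a * (cis (\<xi> * x) * char (distr M borel X) \<xi>)
      + trig_poly l \<xi> * char (distr M borel X) \<xi>)"
    using Cons.IH by (intro Bochner_Integration.integrable_add) auto
  then show ?case by (simp add: p algebra_simps)
qed simp

lemma inversion_density_nonneg: "0 \<le> inversion_density X x y"
  and distributed_inversion_density:
    "distributed M lborel (\<lambda>\<omega>. x + X \<omega>) (\<lambda>y. ennreal (inversion_density X x y))"
proof -
  have *: "char (distr M borel (\<lambda>\<omega>. x + X \<omega>)) = (\<lambda>\<xi>. cis (\<xi> * x) * char (distr M borel X) \<xi>)"
    by (auto simp: char_distr_translate cis_conv_exp)
  have int: "integrable lborel (char (distr M borel (\<lambda>\<omega>. x + X \<omega>)))"
    using integrable_trig_poly_char[of "[(1, x)]"] by (simp add: *)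
  have rv: "random_variable borel (\<lambda>\<omega>. x + X \<omega>)" by measurable
  show "0 \<le> inversion_density X x y" "distributed M lborel (\<lambda>\<omega>. x + X \<omega>) (\<lambda>y. ennreal (inversion_density X x y))"
    using distributed_of_integrable_char[OF rv int] by (simp_all add: inversion_density_def *)
qed

lemma measurable_inversion_density[measurable]: "inversion_density X x \<in> borel_measurable borel"
  using distributed_real_measurable[OF _ distributed_inversion_density[of x]] inversion_density_nonneg by simp

lemma integrable_inversion_density: "integrable lborel (inversion_density X x)"
proof -
  have "(\<integral>\<^sup>+y. ennreal (inversion_density X x y) \<partial>lborel) = emeasure (density lborel (\<lambda>y. ennreal (inversion_density X x y))) UNIV"
    by (simp add: emeasure_density)
  also have "\<dots> = emeasure (distr M lborel (\<lambda>\<omega>. x + X \<omega>)) UNIV"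
    using distributed_distr_eq_density[OF distributed_inversion_density[of x]] by simp
  also have "\<dots> = 1" by (simp add: emeasure_distr emeasure_space_1)
  finally show ?thesis
    by (intro integrableI_nonneg) (auto simp: inversion_density_nonneg)
qed

text \<open>Shifting the law by x multiplies its characteristic function by cis(\<xi> x), so the
  combination of shifted densities has transform \<open>trig_poly l\<close> times the characteristic
  function of X. Both this and the inverse relation are linear in the list, hence the two inductions
  before Plancherel applies.\<close>

lemma L2_norm_of_translates:
  "(\<integral>\<^sup>+y. ennreal ((\<Sum>(a, x)\<leftarrow>l. a * inversion_density X x y)\<^sup>2) \<partial>lborel) =
    (\<integral>\<^sup>+\<xi>. ennreal ((cmod (trig_poly l \<xi> * char (distr M borel X) \<xi>))\<^sup>2 / (2 * pi)) \<partial>lborel)"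
proof (rule plancherel_of_inversion)
  let ?\<phi> = "char (distr M borel X)"
  let ?f = "\<lambda>l y. \<Sum>(a, x)\<leftarrow>l. a * inversion_density X x y"
  show int: "integrable lborel (?f l)" for l
    by (induction l) (auto simp: integrable_inversion_density)
  show "integrable lborel (\<lambda>\<xi>. trig_poly l \<xi> * ?\<phi> \<xi>)" by (rule integrable_trig_poly_char)
  have iexp_int: "integrable lborel (\<lambda>y. iexp (\<xi> * y) * complex_of_real (f y))" if "integrable lborel f" for f \<xi>
    by (rule Bochner_Integration.integrable_bound[OF that]) (use that in \<open>auto simp: norm_mult\<close>)
  show "trig_poly l \<xi> * ?\<phi> \<xi> = (CLBINT y. iexp (\<xi> * y) * complex_of_real (?f l y))" for \<xi>
  proof (induction l)
    case (Cons p l)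
    obtain a x where p: "p = (a, x)" by (cases p)
    have "(CLBINT y. iexp (\<xi> * y) * complex_of_real (?f (p # l) y)) =
        (CLBINT y. complex_of_real a * (iexp (\<xi> * y) * complex_of_real (inversion_density X x y))
          + iexp (\<xi> * y) * complex_of_real (?f l y))"
      by (simp add: p algebra_simps)
    also have "\<dots> = complex_of_real a * (CLBINT y. iexp (\<xi> * y) * complex_of_real (inversion_density X x y))
        + (CLBINT y. iexp (\<xi> * y) * complex_of_real (?f l y))"
      using iexp_int[OF integrable_inversion_density] iexp_int[OF int]
      by (subst Bochner_Integration.integral_add) auto
    also have "(CLBINT y. iexp (\<xi> * y) * complex_of_real (inversion_density X x y)) = cis (\<xi> * x) * ?\<phi> \<xi>"
      using char_of_density[OF distributed_inversion_density measurable_inversion_density inversion_density_nonneg, of x \<xi>]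
      by (simp add: char_distr_translate cis_conv_exp)
    finally show ?case using Cons.IH by (simp add: p algebra_simps)
  qed simp
  have iexp_int': "integrable lborel (\<lambda>\<xi>. iexp (- (\<xi> * y)) * (trig_poly l \<xi> * ?\<phi> \<xi>))" for l y
    by (rule Bochner_Integration.integrable_bound[OF integrable_trig_poly_char[of l]]) (auto simp: norm_mult)
  show "?f l y = Re (CLBINT \<xi>. iexp (- (\<xi> * y)) * (trig_poly l \<xi> * ?\<phi> \<xi>)) / (2 * pi)" for y
  proof (induction l)
    case (Cons p l)
    obtain a x where p: "p = (a, x)" by (cases p)
    have "(CLBINT \<xi>. iexp (- (\<xi> * y)) * (trig_poly (p # l) \<xi> * ?\<phi> \<xi>)) =
        (CLBINT \<xi>. complex_of_real a * (iexp (- (\<xi> * y)) * (cis (\<xi> * x) * ?\<phi> \<xi>))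
          + iexp (- (\<xi> * y)) * (trig_poly l \<xi> * ?\<phi> \<xi>))"
      by (simp add: p algebra_simps)
    also have "\<dots> = complex_of_real a * (CLBINT \<xi>. iexp (- (\<xi> * y)) * (cis (\<xi> * x) * ?\<phi> \<xi>))
        + (CLBINT \<xi>. iexp (- (\<xi> * y)) * (trig_poly l \<xi> * ?\<phi> \<xi>))"
      using iexp_int'[of y "[(1, x)]"] iexp_int'[of y l]
      by (subst Bochner_Integration.integral_add) auto
    finally show ?case using Cons.IH by (simp add: p inversion_density_def add_divide_distrib)
  qed simp
qed

end

end

section \<open>Transition densities of the process\<close>

lemma integrable_inverse_1_plus_square': "integrable lborel (\<lambda>x::real. inverse (1 + x\<^sup>2))"
  using integrable_inverse_1_plus_square by (simp add: set_integrable_def)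

locale log_growth_levy_process =
  fixes M :: "'a measure" and X :: "real \<Rightarrow> 'a \<Rightarrow> real" and \<Psi> :: "real \<Rightarrow> complex"
  assumes levy: "levy_process M X" and exponent: "characteristic_exponent M X \<Psi>"
    and growth: "filterlim (\<lambda>\<xi>. Re (\<Psi> \<xi>) / ln \<bar>\<xi>\<bar>) at_top at_infinity"
begin

sublocale prob_space M using levy by (simp add: levy_process_def)

lemma measurable_process: "0 \<le> s \<Longrightarrow> X s \<in> borel_measurable M"
  using levy by (simp add: levy_process_def)

lemma char_process: "0 \<le> s \<Longrightarrow> char (distr M borel (X s)) \<xi> = exp (- of_real s * \<Psi> \<xi>)"
  using exponent by (simp add: characteristic_exponent_def)

lemma norm_char_process: "0 \<le> s \<Longrightarrow> cmod (char (distr M borel (X s)) \<xi>) = exp (- s * Re (\<Psi> \<xi>))"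
  by (simp add: char_process)

lemma real_distribution_process: "0 \<le> s \<Longrightarrow> real_distribution (distr M borel (X s))"
  using measurable_process by simp

lemma Re_exponent_nonneg: "0 \<le> Re (\<Psi> \<xi>)"
  using real_distribution.cmod_char_le_1[OF real_distribution_process[of 1], of \<xi>]
  by (simp add: norm_char_process)

lemma measurable_char_process[measurable]: "0 \<le> s \<Longrightarrow> char (distr M borel (X s)) \<in> borel_measurable borel"
  using real_distribution.char_measurable[OF real_distribution_process] by simp

text \<open>\<Psi> is given only through its exponentials, so its real part is read off as minus the
  logarithm of the modulus of the characteristic function at time 1.\<close>

lemma measurable_Re_exponent[measurable]: "(\<lambda>\<xi>. Re (\<Psi> \<xi>)) \<in> borel_measurable borel"
proof -
  note [measurable] = measurable_char_process[of 1]
  have "(\<lambda>\<xi>. Re (\<Psi> \<xi>)) = (\<lambda>\<xi>. - ln (cmod (char (distr M borel (X 1)) \<xi>)))"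
    by (simp add: norm_char_process)
  also have "\<dots> \<in> borel_measurable borel" by measurable
  finally show ?thesis .
qed

lemma polynomial_times_exp_bound:
  assumes "0 < s"
  shows "\<exists>C\<ge>0. \<forall>\<xi>. \<xi> ^ (2 * k) * exp (- s * Re (\<Psi> \<xi>)) \<le> C * inverse (1 + \<xi>\<^sup>2)"
proof -
  \<comment> \<open>Chosen so that Re \<Psi> \<ge> K ln |\<xi>| gives exp(-s Re \<Psi>) \<le>
    |\<xi>|^-(2k+2): the polynomial is compensated and \<xi>^-2 is left over.\<close>
  define K where "K = (2 * real k + 2) / s"
  have "\<forall>\<^sub>F \<xi> in at_infinity. K \<le> Re (\<Psi> \<xi>) / ln \<bar>\<xi>\<bar>"
    using growth by (simp add: filterlim_at_top)
  then obtain b0 where b0: "\<And>\<xi>. b0 \<le> \<bar>\<xi>\<bar> \<Longrightarrow> K \<le> Re (\<Psi> \<xi>) / ln \<bar>\<xi>\<bar>"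
    by (auto simp: eventually_at_infinity)
  \<comment> \<open>Taking b at least 2 makes ln |\<xi>| positive beyond b, so the quotient bound
    may be multiplied out.\<close>
  define b where "b = max b0 2"
  have tail: "\<xi> ^ (2 * k) * exp (- s * Re (\<Psi> \<xi>)) \<le> 2 * inverse (1 + \<xi>\<^sup>2)" if "b \<le> \<bar>\<xi>\<bar>" for \<xi>
  proof -
    have \<xi>: "2 \<le> \<bar>\<xi>\<bar>" "b0 \<le> \<bar>\<xi>\<bar>" using that by (auto simp: b_def)
    then have "0 < ln \<bar>\<xi>\<bar>" by simp
    then have "K * ln \<bar>\<xi>\<bar> \<le> Re (\<Psi> \<xi>)" using b0[OF \<xi>(2)] by (simp add: pos_le_divide_eq)
    then have "s * (K * ln \<bar>\<xi>\<bar>) \<le> s * Re (\<Psi> \<xi>)" using assms by (intro mult_left_mono) auto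
    then have "(2 * real k + 2) * ln \<bar>\<xi>\<bar> \<le> s * Re (\<Psi> \<xi>)" using assms by (simp add: K_def)
    then have "exp (- s * Re (\<Psi> \<xi>)) \<le> exp (- (real (2 * k + 2) * ln \<bar>\<xi>\<bar>))" by (simp add: add.commute)
    also have "\<dots> = inverse (\<bar>\<xi>\<bar> ^ (2 * k + 2))"
      using \<xi> unfolding exp_minus exp_of_nat_mult by simp
    finally have "\<xi> ^ (2 * k) * exp (- s * Re (\<Psi> \<xi>)) \<le> \<xi> ^ (2 * k) * inverse (\<bar>\<xi>\<bar> ^ (2 * k + 2))"
      by (intro mult_left_mono) auto
    also have "\<dots> = inverse (\<xi>\<^sup>2)"
    proof -
      have "\<xi> \<noteq> 0" using \<xi> by auto
      then show ?thesis by (simp add: power_add power_even_abs field_simps power2_eq_square)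
    qed
    also have "\<dots> \<le> 2 * inverse (1 + \<xi>\<^sup>2)"
    proof -
      have "1 \<le> \<xi>\<^sup>2" using \<xi> by (simp add: abs_square_le_1[symmetric] one_le_power[of "\<bar>\<xi>\<bar>" 2, simplified])
      then have "0 < \<xi>\<^sup>2" by linarith
      with \<open>1 \<le> \<xi>\<^sup>2\<close> show ?thesis by (simp add: divide_simps)
    qed
    finally show ?thesis .
  qed
  have mid: "\<xi> ^ (2 * k) * exp (- s * Re (\<Psi> \<xi>)) \<le> (b ^ (2 * k) * (1 + b\<^sup>2)) * inverse (1 + \<xi>\<^sup>2)" if "\<bar>\<xi>\<bar> \<le> b" for \<xi>
  proof -
    have "\<bar>\<xi>\<bar> ^ (2 * k) \<le> b ^ (2 * k)" "\<bar>\<xi>\<bar>\<^sup>2 \<le> b\<^sup>2" using that by (intro power_mono; simp)+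
    moreover have "exp (- s * Re (\<Psi> \<xi>)) \<le> 1" using assms Re_exponent_nonneg[of \<xi>] by simp
    ultimately have "\<xi> ^ (2 * k) * exp (- s * Re (\<Psi> \<xi>)) \<le> b ^ (2 * k) * 1"
      by (intro mult_mono) (auto simp: power_even_abs b_def)
    also have "\<dots> \<le> b ^ (2 * k) * ((1 + b\<^sup>2) * inverse (1 + \<xi>\<^sup>2))"
    proof (rule mult_left_mono)
      have "0 < 1 + \<xi>\<^sup>2" by (simp add: add_pos_nonneg)
      then show "1 \<le> (1 + b\<^sup>2) * inverse (1 + \<xi>\<^sup>2)" using \<open>\<bar>\<xi>\<bar>\<^sup>2 \<le> b\<^sup>2\<close> by (simp add: field_simps)
    qed (auto simp: b_def)
    finally show ?thesis by (simp add: mult.assoc)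
  qed
  let ?C = "max 2 (b ^ (2 * k) * (1 + b\<^sup>2))"
  have "\<xi> ^ (2 * k) * exp (- s * Re (\<Psi> \<xi>)) \<le> ?C * inverse (1 + \<xi>\<^sup>2)" for \<xi>
  proof (cases "b \<le> \<bar>\<xi>\<bar>")
    case True
    from tail[OF this] show ?thesis
      by (rule order_trans) (intro mult_right_mono, auto simp: add_nonneg_nonneg)
  next
    case False
    then have "\<bar>\<xi>\<bar> \<le> b" by simp
    from mid[OF this] show ?thesis
      by (rule order_trans) (intro mult_right_mono, auto simp: add_nonneg_nonneg)
  qed
  then show ?thesis by (intro exI[of _ ?C]) auto
qed

lemma exp_moments_finite:
  assumes "0 < s"
  shows "integrable lborel (\<lambda>\<xi>. \<xi> ^ (2 * k) * exp (- s * Re (\<Psi> \<xi>)))"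
proof -
  obtain C where C: "0 \<le> C" "\<And>\<xi>. \<xi> ^ (2 * k) * exp (- s * Re (\<Psi> \<xi>)) \<le> C * inverse (1 + \<xi>\<^sup>2)"
    using polynomial_times_exp_bound[OF assms] by blast
  show ?thesis
    by (rule Bochner_Integration.integrable_bound[of _ "\<lambda>\<xi>. C * inverse (1 + \<xi>\<^sup>2)"])
       (use C integrable_inverse_1_plus_square' in \<open>auto simp: abs_mult intro!: order_trans[OF _ abs_ge_self]\<close>)
qed

lemma integrable_char_process: "0 < s \<Longrightarrow> integrable lborel (char (distr M borel (X s)))"
  using exp_moments_finite[of s 0]
  by (intro Bochner_Integration.integrable_bound[of _ "\<lambda>\<xi>. exp (- s * Re (\<Psi> \<xi>))" "char (distr M borel (X s))"])
     (auto simp: norm_char_process intro: measurable_char_process)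

lemma continuous_on_inversion_density:
  "continuous_on ({0<..} \<times> UNIV \<times> UNIV) (\<lambda>(s, x, y). inversion_density (X s) x y)"
proof (rule continuous_on_sequentiallyI)
  fix u :: "nat \<Rightarrow> real \<times> real \<times> real" and a
  assume u: "\<forall>n. u n \<in> {0<..} \<times> UNIV \<times> UNIV" and a: "a \<in> {0<..} \<times> UNIV \<times> UNIV" and lim: "u \<longlonglongrightarrow> a"
  obtain s x y where a_eq: "a = (s, x, y)" by (cases a)
  define sn xn yn where "sn n = fst (u n)" and "xn n = fst (snd (u n))" and "yn n = snd (snd (u n))" for n
  have u_eq: "u n = (sn n, xn n, yn n)" for n by (simp add: sn_def xn_def yn_def)
  have lims: "sn \<longlonglongrightarrow> s" "xn \<longlonglongrightarrow> x" "yn \<longlonglongrightarrow> y"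
    using tendsto_fst[OF lim] tendsto_fst[OF tendsto_snd[OF lim]] tendsto_snd[OF tendsto_snd[OF lim]]
    unfolding a_eq sn_def[abs_def] xn_def[abs_def] yn_def[abs_def] by simp_all
  have "0 < s" using a by (simp add: a_eq)
  have pos: "0 < sn n" for n using u by (simp add: u_eq)
  \<comment> \<open>The dominating function is the modulus of the integrand at time s / 2; it works
    only once the times exceed s / 2, so the sequence is shifted by k.\<close>
  have "\<forall>\<^sub>F n in sequentially. s / 2 < sn n"
    using lims(1) \<open>0 < s\<close> by (intro order_tendstoD) auto
  then obtain k where k: "\<And>n. k \<le> n \<Longrightarrow> s / 2 < sn n" by (auto simp: eventually_sequentially)
  let ?h = "\<lambda>s x y \<xi>. iexp (- (\<xi> * y)) * (cis (\<xi> * x) * char (distr M borel (X s)) \<xi>)"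
  have "(\<lambda>n. CLBINT \<xi>. ?h (sn (n + k)) (xn (n + k)) (yn (n + k)) \<xi>) \<longlonglongrightarrow> (CLBINT \<xi>. ?h s x y \<xi>)"
  proof (rule integral_dominated_convergence)
    show "integrable lborel (\<lambda>\<xi>. exp (- (s / 2) * Re (\<Psi> \<xi>)))"
      using exp_moments_finite[of "s / 2" 0] \<open>0 < s\<close> by simp
    show "AE \<xi> in lborel. (\<lambda>n. ?h (sn (n + k)) (xn (n + k)) (yn (n + k)) \<xi>) \<longlonglongrightarrow> ?h s x y \<xi>"
    proof (rule AE_I2)
      fix \<xi> :: real
      have "(\<lambda>n. exp (\<i> * of_real (- (\<xi> * yn n))) * (exp (\<i> * of_real (\<xi> * xn n)) * exp (- of_real (sn n) * \<Psi> \<xi>)))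
          \<longlonglongrightarrow> exp (\<i> * of_real (- (\<xi> * y))) * (exp (\<i> * of_real (\<xi> * x)) * exp (- of_real s * \<Psi> \<xi>))"
        by (intro tendsto_intros lims)
      then have "(\<lambda>n. ?h (sn n) (xn n) (yn n) \<xi>) \<longlonglongrightarrow> ?h s x y \<xi>"
        using pos \<open>0 < s\<close> by (simp add: char_process less_imp_le cis_conv_exp)
      then show "(\<lambda>n. ?h (sn (n + k)) (xn (n + k)) (yn (n + k)) \<xi>) \<longlonglongrightarrow> ?h s x y \<xi>"
        by (rule LIMSEQ_ignore_initial_segment)
    qed
    show "AE \<xi> in lborel. norm (?h (sn (n + k)) (xn (n + k)) (yn (n + k)) \<xi>) \<le> exp (- (s / 2) * Re (\<Psi> \<xi>))" for n
    proof (rule AE_I2)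
      fix \<xi> :: real
      have "s / 2 * Re (\<Psi> \<xi>) \<le> sn (n + k) * Re (\<Psi> \<xi>)"
        using k[of "n + k"] Re_exponent_nonneg[of \<xi>] by (intro mult_right_mono) auto
      then show "norm (?h (sn (n + k)) (xn (n + k)) (yn (n + k)) \<xi>) \<le> exp (- (s / 2) * Re (\<Psi> \<xi>))"
        using pos[of "n + k"] by (simp add: norm_mult norm_char_process)
    qed
    have h_meas: "?h s x y \<in> borel_measurable lborel" if "0 < s" for s x y
    proof -
      note [measurable] = measurable_char_process[OF less_imp_le[OF that]]
      show ?thesis unfolding cis_conv_exp by measurable
    qed
    show "?h s x y \<in> borel_measurable lborel" using h_meas \<open>0 < s\<close> .
    show "?h (sn (n + k)) (xn (n + k)) (yn (n + k)) \<in> borel_measurable lborel" for n using h_meas pos .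
  qed
  then have "(\<lambda>n. inversion_density (X (sn (n + k))) (xn (n + k)) (yn (n + k))) \<longlonglongrightarrow> inversion_density (X s) x y"
    unfolding inversion_density_def by (intro tendsto_intros) auto
  then have "(\<lambda>n. inversion_density (X (sn n)) (xn n) (yn n)) \<longlonglongrightarrow> inversion_density (X s) x y"
    by (rule LIMSEQ_offset)
  then show "(\<lambda>n. case u n of (s, x, y) \<Rightarrow> inversion_density (X s) x y) \<longlonglongrightarrow>
      (case a of (s, x, y) \<Rightarrow> inversion_density (X s) x y)"
    by (simp add: u_eq a_eq)
qed

text \<open>The choice by \<open>SOME\<close> has the defining properties as soon as some family of
  jointly continuous densities exists; the inversion densities are such a family.\<close>

lemma continuous_transition_densities_transition_density:
  "continuous_transition_densities M X (transition_density M X)"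
proof -
  have "continuous_transition_densities M X (\<lambda>s. inversion_density (X s))"
    unfolding continuous_transition_densities_def
    using continuous_on_inversion_density
      inversion_density_nonneg[OF measurable_process integrable_char_process]
      distributed_inversion_density[OF measurable_process integrable_char_process]
    by (simp add: less_imp_le)
  then show ?thesis unfolding transition_density_def by (rule someI[where P="continuous_transition_densities M X"])
qed

text \<open>Densities of one law agree almost everywhere, and this is enough because the densities
  are compared only under integrals over y.\<close>

lemma AE_transition_density_eq:
  assumes "0 < s"
  shows "AE y in lborel. transition_density M X s x y = inversion_density (X s) x y"
proof -
  have "AE y in lborel. ennreal (transition_density M X s x y) = ennreal (inversion_density (X s) x y)"
    using continuous_transition_densities_transition_density assms
      distributed_inversion_density[OF measurable_process[of s] integrable_char_process[OF assms], of x]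
    by (intro distributed_unique[of lborel "\<lambda>\<omega>. x + X s \<omega>"]) (auto simp: continuous_transition_densities_def)
  moreover have "0 \<le> transition_density M X s x y" "0 \<le> inversion_density (X s) x y" for y
    using continuous_transition_densities_transition_density assms
      inversion_density_nonneg[OF measurable_process[of s] integrable_char_process[OF assms]]
    by (auto simp: continuous_transition_densities_def)
  ultimately show ?thesis by simp
qed

lemma L2_norm_transition_density:
  assumes "0 < s"
  shows "(\<integral>\<^sup>+y. ennreal ((\<Sum>(a, x)\<leftarrow>l. a * transition_density M X s x y)\<^sup>2) \<partial>lborel) =
    (\<integral>\<^sup>+\<xi>. ennreal ((cmod (trig_poly l \<xi>))\<^sup>2 * exp (- 2 * s * Re (\<Psi> \<xi>)) / (2 * pi)) \<partial>lborel)"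
proof -
  have "AE y in lborel. (\<Sum>(a, x)\<leftarrow>l. a * transition_density M X s x y) = (\<Sum>(a, x)\<leftarrow>l. a * inversion_density (X s) x y)"
  proof (induction l)
    case (Cons p l)
    obtain a x where p: "p = (a, x)" by (cases p)
    from Cons.IH AE_transition_density_eq[OF assms, of x] show ?case
      by eventually_elim (simp add: p)
  qed simp
  then have "(\<integral>\<^sup>+y. ennreal ((\<Sum>(a, x)\<leftarrow>l. a * transition_density M X s x y)\<^sup>2) \<partial>lborel) =
      (\<integral>\<^sup>+y. ennreal ((\<Sum>(a, x)\<leftarrow>l. a * inversion_density (X s) x y)\<^sup>2) \<partial>lborel)"
    by (intro nn_integral_cong_AE) (auto elim: eventually_mono)
  also have "\<dots> = (\<integral>\<^sup>+\<xi>. ennreal ((cmod (trig_poly l \<xi> * char (distr M borel (X s)) \<xi>))\<^sup>2 / (2 * pi)) \<partial>lborel)"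
    using assms by (intro L2_norm_of_translates measurable_process integrable_char_process) auto
  also have "\<dots> = (\<integral>\<^sup>+\<xi>. ennreal ((cmod (trig_poly l \<xi>))\<^sup>2 * exp (- 2 * s * Re (\<Psi> \<xi>)) / (2 * pi)) \<partial>lborel)"
  proof (intro nn_integral_cong)
    fix \<xi>
    have "(exp (- s * Re (\<Psi> \<xi>)))\<^sup>2 = exp (- 2 * s * Re (\<Psi> \<xi>))"
      by (simp add: power2_eq_square flip: exp_add)
    then show "ennreal ((cmod (trig_poly l \<xi> * char (distr M borel (X s)) \<xi>))\<^sup>2 / (2 * pi)) =
        ennreal ((cmod (trig_poly l \<xi>))\<^sup>2 * exp (- 2 * s * Re (\<Psi> \<xi>)) / (2 * pi))"
      using assms by (simp only: norm_mult norm_char_process less_imp_le power_mult_distrib)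
  qed
  finally show ?thesis .
qed

end

section \<open>The Wiener integrand and its spectral weight\<close>

locale levy_white_noise = log_growth_levy_process M X \<Psi> + white_noise_field N space_time W
  for M :: "'a measure" and X \<Psi> and N :: "'b measure" and W +
  fixes t \<alpha> :: real
  assumes t_pos: "0 < t" and \<alpha>_pos: "0 < \<alpha>"
begin

text \<open>It has the type of a field whose sample space is space-time, so \<open>lin_comb\<close>
  applies and one list describes a combination of kernels, of their Wiener integrals, and a
  trigonometric polynomial.\<close>

definition kernel :: "real \<Rightarrow> real \<times> real \<Rightarrow> real" where
  "kernel x = (\<lambda>(s, y). indicator {t..} s * (exp (- \<alpha> * s / 2) * transition_density M X s x y))"

text \<open>Since t > 0, times s \<ge> t stay in the region where the densities are jointly
  continuous; the kernel is a continuous function there, cut off outside a closed set.\<close>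

lemma measurable_kernel[measurable]: "kernel x \<in> borel_measurable space_time"
proof -
  have "continuous_on ({0<..} \<times> UNIV \<times> UNIV) (\<lambda>(s, x, y). transition_density M X s x y)"
    using continuous_transition_densities_transition_density by (simp add: continuous_transition_densities_def)
  moreover have "continuous_on ({t..} \<times> UNIV) (\<lambda>z :: real \<times> real. (fst z, x, snd z))"
    by (intro continuous_intros)
  moreover have "(\<lambda>z :: real \<times> real. (fst z, x, snd z)) ` ({t..} \<times> UNIV) \<subseteq> {0<..} \<times> UNIV \<times> UNIV"
    using t_pos by auto
  ultimately have "continuous_on ({t..} \<times> UNIV) (\<lambda>z. transition_density M X (fst z) x (snd z))"
    using continuous_on_compose2[of _ "\<lambda>(s, x, y). transition_density M X s x y"] by fastforce
  then have "continuous_on ({t..} \<times> UNIV) (\<lambda>z. exp (- \<alpha> * fst z / 2) * transition_density M X (fst z) x (snd z))"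
    by (intro continuous_on_mult) (intro continuous_intros, simp_all)
  then have "(\<lambda>z. indicator ({t..} \<times> UNIV) z *\<^sub>R (exp (- \<alpha> * fst z / 2) * transition_density M X (fst z) x (snd z)))
      \<in> borel_measurable (borel :: (real \<times> real) measure)"
    by (rule borel_measurable_continuous_on_indicator[rotated]) (intro borel_closed closed_Times closed_UNIV closed_atLeast)
  also have "(\<lambda>z. indicator ({t..} \<times> UNIV) z *\<^sub>R (exp (- \<alpha> * fst z / 2) * transition_density M X (fst z) x (snd z))) = kernel x"
    by (auto simp: kernel_def fun_eq_iff split: split_indicator)
  finally have 1: "kernel x \<in> borel_measurable borel" .
  have "(\<lambda>z. (fst z, snd z)) \<in> space_time \<rightarrow>\<^sub>M (borel :: real measure) \<Otimes>\<^sub>M (borel :: real measure)"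
    unfolding space_time_def
    by (intro measurable_Pair measurable_compose[OF measurable_fst] measurable_compose[OF measurable_snd] measurable_restrict_space1) auto
  then have "(\<lambda>z. z) \<in> space_time \<rightarrow>\<^sub>M (borel :: (real \<times> real) measure)" by (simp add: borel_prod)
  from measurable_compose[OF this 1] show ?thesis by simp
qed

text \<open>exp(-\<alpha> t) / \<alpha> is the integral of exp(-\<alpha> s) over s \<ge> t, exp(-2 t
  Re \<Psi>) is the squared modulus of the characteristic function at time t, and 1 / (2 pi) comes
  from Plancherel's identity.\<close>

definition spectral_weight :: "real \<Rightarrow> real" where
  "spectral_weight \<xi> = exp (- \<alpha> * t) / \<alpha> * (exp (- 2 * t * Re (\<Psi> \<xi>)) / (2 * pi))"

lemma measurable_spectral_weight[measurable]: "spectral_weight \<in> borel_measurable borel"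
  unfolding spectral_weight_def by measurable

lemma spectral_weight_nonneg: "0 \<le> spectral_weight \<xi>"
  using \<alpha>_pos by (simp add: spectral_weight_def)

lemma spectral_weight_moments: "(\<integral>\<^sup>+\<xi>. ennreal (\<xi> ^ (2 * k) * spectral_weight \<xi>) \<partial>lborel) < \<infinity>"
proof -
  have "integrable lborel (\<lambda>\<xi>. exp (- \<alpha> * t) / \<alpha> / (2 * pi) * (\<xi> ^ (2 * k) * exp (- (2 * t) * Re (\<Psi> \<xi>))))"
    using exp_moments_finite[of "2 * t" k] t_pos by (intro integrable_mult_right) auto
  then have "integrable lborel (\<lambda>\<xi>. \<xi> ^ (2 * k) * spectral_weight \<xi>)"
    by (simp add: spectral_weight_def mult_ac)
  then show ?thesis
    using spectral_weight_nonneg by (simp add: nn_integral_eq_integral)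
qed

text \<open>The space integral at a fixed time s is evaluated by Plancherel as exp(-\<alpha> s)
  times \<open>J s\<close>. Replacing \<open>J s\<close> by the larger \<open>J t\<close> separates
  the variables and leaves an elementary time integral.\<close>

lemma kernel_L2_bound:
  "(\<integral>\<^sup>+z. ennreal ((lin_comb kernel l z)\<^sup>2) \<partial>space_time) \<le>
    (\<integral>\<^sup>+\<xi>. ennreal ((cmod (trig_poly l \<xi>))\<^sup>2 * spectral_weight \<xi>) \<partial>lborel)"
proof -
  define f where "f s y = (\<Sum>(a, x)\<leftarrow>l. a * transition_density M X s x y)" for s y
  define J where "J s = (\<integral>\<^sup>+\<xi>. ennreal ((cmod (trig_poly l \<xi>))\<^sup>2 * exp (- 2 * s * Re (\<Psi> \<xi>)) / (2 * pi)) \<partial>lborel)" for s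
  have lin: "lin_comb kernel l (s, y) = indicator {t..} s * exp (- \<alpha> * s / 2) * f s y" for s y
    unfolding lin_comb_def f_def by (induction l) (auto simp: kernel_def algebra_simps)
  have inner: "(\<integral>\<^sup>+y. ennreal ((lin_comb kernel l (s, y))\<^sup>2) \<partial>lborel) \<le> ennreal (exp (- \<alpha> * s)) * indicator {t..} s * J t" for s
  proof (cases "t \<le> s")
    case True
    have [measurable]: "f s \<in> borel_measurable borel"
    proof -
      have "transition_density M X s x \<in> borel_measurable borel" for x
        using continuous_transition_densities_transition_density True t_pos
        by (intro borel_measurable_continuous_onI continuous_on_compose2[of "{0<..} \<times> UNIV \<times> UNIV" "\<lambda>(s, x, y). transition_density M X s x y" UNIV "\<lambda>y. (s, x, y)", simplified])
           (auto simp: continuous_transition_densities_def intro!: continuous_intros)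
      then show ?thesis unfolding f_def by (induction l) auto
    qed
    have "(exp (- \<alpha> * s / 2))\<^sup>2 = exp (- \<alpha> * s)" by (simp add: power2_eq_square flip: exp_add)
    then have "(\<integral>\<^sup>+y. ennreal ((lin_comb kernel l (s, y))\<^sup>2) \<partial>lborel) =
        (\<integral>\<^sup>+y. ennreal (exp (- \<alpha> * s)) * ennreal ((f s y)\<^sup>2) \<partial>lborel)"
      using True by (intro nn_integral_cong) (simp only: lin power_mult_distrib, simp add: ennreal_mult')
    also have "\<dots> = ennreal (exp (- \<alpha> * s)) * (\<integral>\<^sup>+y. ennreal ((f s y)\<^sup>2) \<partial>lborel)"
      by (rule nn_integral_cmult) measurable
    also have "(\<integral>\<^sup>+y. ennreal ((f s y)\<^sup>2) \<partial>lborel) = J s"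
      unfolding f_def J_def using True t_pos by (intro L2_norm_transition_density) auto
    also have "J s \<le> J t"
      unfolding J_def
    proof (intro nn_integral_mono ennreal_leI divide_right_mono mult_left_mono)
      fix \<xi>
      show "exp (- 2 * s * Re (\<Psi> \<xi>)) \<le> exp (- 2 * t * Re (\<Psi> \<xi>))"
        using mult_right_mono[OF True Re_exponent_nonneg[of \<xi>]] by simp
    qed auto
    finally show ?thesis using True by (simp add: mult_left_mono)
  next
    case False
    then show ?thesis by (simp add: lin)
  qed
  have "(\<integral>\<^sup>+z. ennreal ((lin_comb kernel l z)\<^sup>2) \<partial>space_time) =
      (\<integral>\<^sup>+s. \<integral>\<^sup>+y. ennreal ((lin_comb kernel l (s, y))\<^sup>2) \<partial>lborel \<partial>restrict_space lborel {0..})"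
    using measurable_lin_comb[of kernel space_time l] unfolding space_time_def
    by (subst lborel.nn_integral_fst[symmetric]) (auto simp: space_time_def[symmetric])
  also have "\<dots> \<le> (\<integral>\<^sup>+s. ennreal (exp (- \<alpha> * s)) * indicator {t..} s * J t \<partial>restrict_space lborel {0..})"
    by (intro nn_integral_mono inner)
  also have "\<dots> \<le> (\<integral>\<^sup>+s. ennreal (exp (- \<alpha> * s)) * indicator {t..} s * J t \<partial>lborel)"
    by (subst nn_integral_restrict_space) (auto intro!: nn_integral_mono split: split_indicator)
  also have "\<dots> = (\<integral>\<^sup>+s. ennreal (exp (- \<alpha> * s)) * indicator {t..} s \<partial>lborel) * J t"
    by (rule nn_integral_multc) measurable
  also have "(\<integral>\<^sup>+s. ennreal (exp (- \<alpha> * s)) * indicator {t..} s \<partial>lborel) = ennreal (0 - (- exp (- \<alpha> * t) / \<alpha>))"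
  proof (rule nn_integral_FTC_atLeast[where F="\<lambda>s. - exp (- \<alpha> * s) / \<alpha>"])
    show "((\<lambda>s. - exp (- \<alpha> * s) / \<alpha>) has_real_derivative exp (- \<alpha> * s)) (at s)" for s
      using \<alpha>_pos by (auto intro!: derivative_eq_intros)
    have "LIM s at_top. - \<alpha> * s :> at_bot"
      using \<alpha>_pos by (intro filterlim_tendsto_neg_mult_at_bot[OF tendsto_const _ filterlim_ident]) auto
    from filterlim_compose[OF exp_at_bot this] have "((\<lambda>s. exp (- \<alpha> * s)) \<longlongrightarrow> 0) at_top" .
    then have "((\<lambda>s. - exp (- \<alpha> * s) / \<alpha>) \<longlongrightarrow> - 0 / \<alpha>) at_top"
      using \<alpha>_pos by (intro tendsto_intros) auto
    then show "((\<lambda>s. - exp (- \<alpha> * s) / \<alpha>) \<longlongrightarrow> 0) at_top" by simp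
  qed auto
  also have "ennreal (0 - (- exp (- \<alpha> * t) / \<alpha>)) * J t = (\<integral>\<^sup>+\<xi>. ennreal ((cmod (trig_poly l \<xi>))\<^sup>2 * spectral_weight \<xi>) \<partial>lborel)"
    unfolding J_def using \<alpha>_pos
    by (subst nn_integral_cmult[symmetric]) (auto simp: spectral_weight_def mult_ac simp flip: ennreal_mult' intro!: nn_integral_cong)
  finally show ?thesis .
qed

lemma S_field_eq: "S_field M X N W \<alpha> t x = wiener_integral N space_time W (kernel x)"
  by (simp add: S_field_def kernel_def)

lemma has_wiener_integral_S_field: "has_wiener_integral N space_time W (kernel x) (S_field M X N W \<alpha> t x)"
  unfolding S_field_eq
proof (rule has_wiener_integral_wiener_integral)
  have "(\<integral>\<^sup>+z. ennreal ((kernel x z)\<^sup>2) \<partial>space_time) \<le>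
      (\<integral>\<^sup>+\<xi>. ennreal ((cmod (trig_poly [(1, x)] \<xi>))\<^sup>2 * spectral_weight \<xi>) \<partial>lborel)"
    using kernel_L2_bound[of "[(1, x)]"] by simp
  also have "\<dots> < \<infinity>" using spectral_weight_moments[of 0] by simp
  finally show "(\<integral>\<^sup>+z. ennreal ((kernel x z)\<^sup>2) \<partial>space_time) < \<infinity>" .
qed measurable

lemma has_wiener_integral_lin_comb:
  "has_wiener_integral N space_time W (lin_comb kernel l) (lin_comb (S_field M X N W \<alpha> t) l)"
proof (induction l)
  case Nil
  show ?case unfolding lin_comb_fun by (rule has_wiener_integral_zero)
next
  case (Cons p l)
  obtain a x where p: "p = (a, x)" by (cases p)
  show ?case
    unfolding p lin_comb_fun by (rule has_wiener_integral_affine[OF has_wiener_integral_S_field Cons.IH])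
qed

text \<open>The 4 is the constant of \<open>has_wiener_integral_L2_bound\<close>. A constant factor
  in the weight is harmless, as only finiteness of its moments matters.\<close>

sublocale S: spectrally_dominated N "\<lambda>\<xi>. 4 * spectral_weight \<xi>" "S_field M X N W \<alpha> t"
proof
  show "S_field M X N W \<alpha> t x \<in> borel_measurable N" for x
    using has_wiener_integral_S_field[of x] by (simp add: has_wiener_integral_def)
  show "(\<integral>\<^sup>+\<xi>. ennreal (\<xi> ^ (2 * k) * (4 * spectral_weight \<xi>)) \<partial>lborel) < \<infinity>" for k
  proof -
    have "(\<integral>\<^sup>+\<xi>. ennreal (\<xi> ^ (2 * k) * (4 * spectral_weight \<xi>)) \<partial>lborel) =
        (\<integral>\<^sup>+\<xi>. 4 * ennreal (\<xi> ^ (2 * k) * spectral_weight \<xi>) \<partial>lborel)"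
      by (intro nn_integral_cong) (simp add: mult.left_commute ennreal_mult')
    then show ?thesis using spectral_weight_moments[of k] by (simp add: nn_integral_cmult ennreal_mult_less_top)
  qed
  show "(\<integral>\<^sup>+\<omega>. ennreal ((lin_comb (S_field M X N W \<alpha> t) l \<omega>)\<^sup>2) \<partial>N) \<le>
      (\<integral>\<^sup>+\<xi>. ennreal ((cmod (trig_poly l \<xi>))\<^sup>2 * (4 * spectral_weight \<xi>)) \<partial>lborel)" for l
  proof -
    have "(\<integral>\<^sup>+\<omega>. ennreal ((lin_comb (S_field M X N W \<alpha> t) l \<omega>)\<^sup>2) \<partial>N) \<le>
        4 * (\<integral>\<^sup>+z. ennreal ((lin_comb kernel l z)\<^sup>2) \<partial>space_time)"
      by (rule has_wiener_integral_L2_bound[OF has_wiener_integral_lin_comb])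
    also have "\<dots> \<le> 4 * (\<integral>\<^sup>+\<xi>. ennreal ((cmod (trig_poly l \<xi>))\<^sup>2 * spectral_weight \<xi>) \<partial>lborel)"
      by (intro mult_left_mono kernel_L2_bound) auto
    also have "\<dots> = (\<integral>\<^sup>+\<xi>. ennreal ((cmod (trig_poly l \<xi>))\<^sup>2 * (4 * spectral_weight \<xi>)) \<partial>lborel)"
      by (subst nn_integral_cmult[symmetric]) (auto simp: mult.left_commute ennreal_mult' intro!: nn_integral_cong)
    finally show ?thesis .
  qed
qed (auto simp: spectral_weight_nonneg)

end

theorem proposition4p1:
  fixes M :: "'a measure" and X :: "real \<Rightarrow> 'a \<Rightarrow> real" and \<Psi> :: "real \<Rightarrow> complex"
    and N :: "'b measure" and W :: "(real \<times> real) set \<Rightarrow> 'b \<Rightarrow> real"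
    and t \<alpha> :: real
  assumes "levy_process M X"
    and "characteristic_exponent M X \<Psi>"
    and "\<exists>\<beta>>0. integrable lborel (\<lambda>\<xi>::real. 1 / (\<beta> + 2 * Re (\<Psi> \<xi>)))"
    and "filterlim (\<lambda>\<xi>::real. Re (\<Psi> \<xi>) / ln \<bar>\<xi>\<bar>) at_top at_infinity"
    and "white_noise N space_time W"
    and "t > 0" and "\<alpha> > 0"
  shows "\<exists>Z. modification N (S_field M X N W \<alpha> t) Z \<and>
           (\<forall>\<omega>\<in>space N. (\<lambda>x. Z x \<omega>) \<in> C_infinity)"
proof -
  interpret levy_white_noise M X \<Psi> N W t \<alpha>
    using assms by unfold_locales
  show ?thesis by (rule S.smooth_modification)
qed

end
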